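(* Let $X^*\in\mathcal{X}^*$ be an optimal solution of $\min_{X\in\mathcal{S}_n}f(X)$ with $\operatorname{rank}(X^* )=r$ and $\lambda_{n-r}(\nabla f(X^* ))-\lambda_n(\nabla f(X^* ))>0$. Let $\delta$ satisfy $0<\delta\le\lambda_{n-r}(\nabla f(X^* ))-\lambda_n(\nabla f(X^* ))$, and let $R_0=\frac18\big(r\beta+\frac{\sqrt{2r}B}{\lambda_r(X^* )}\big)^{-1}\delta$. Suppose projected SGD with mini-batches (as described in the context) is initialized from a "warm-start", i.e. from $X_1\in\mathcal{S}_n$ with $\operatorname{rank}(X_1)\le r$ and $\|X_1-X^*\|_F\le R_0/2$, and is run for a suitable number $T$ of iterations with step-size $\eta=\frac{R_0}{10G\sqrt T\log(8T)}$ and a suitable mini-batch size $L=O\big(\max\{(\frac{\sigma}{GR_0})^2,\frac{B^2r^2}{\delta^2}\log(nT)\}\big)$. Then for all sufficiently small $\epsilon>0$, the overall sample complexity (total number of stochastic oracle calls, i.e. number of iterations times mini-batch size) to achieve $f(\bar X)-f^*\le\epsilon$ with probability at least $1/2$ is upper-bounded by $$\tilde O\Big(\epsilon^{-2}\max\{\sigma^2,\ \lambda_r^2(X^* )\,r\,G^2\}\Big).$$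
   Context: $\mathbb{S}^n$ is the space of $n\times n$ real symmetric matrices, $\|\cdot\|_F$ the Frobenius norm, $\|\cdot\|$ the spectral norm; $\lambda_1(M)\ge\dots\ge\lambda_n(M)$ are the eigenvalues of $M\in\mathbb{S}^n$. The spectrahedron is $\mathcal{S}_n=\{X\in\mathbb{S}^n: X\succeq0,\ \operatorname{Tr}(X)=1\}$ and $\Pi_{\mathcal{S}_n}$ is the Euclidean (Frobenius) projection onto it. The function $f:\mathbb{S}^n\to\mathbb{R}$ is convex and $\beta$-smooth, i.e. $\|\nabla f(X)-\nabla f(Y)\|_F\le\beta\|X-Y\|_F$. $\mathcal{X}^*$ is the set of minimizers of $f$ over $\mathcal{S}_n$, and $f^*$ the minimal value. It is understood that $r<n$. Stochastic oracle: $f$ is accessed through a stochastic first-order oracle which, queried with a point $X\in\mathbb{S}^n$, returns a random matrix $\widehat\nabla\in\mathbb{S}^n$ such that (i) $\mathbb{E}[\widehat\nabla\mid X]=\nabla f(X)$; (ii) $\|\widehat\nabla\|_F\le G$ and $\|\widehat\nabla\|\le B$; (iii) $\mathbb{E}[\|\widehat\nabla-\nabla f(X)\|_F^2\mid X]\le\sigma^2$, for some constants $G,B,\sigma^2>0$. Different oracle calls use independent randomness. Projected SGD with mini-batches: input $X_1\in\mathcal{S}_n$, batch-size $L$, horizon $T$, step-size $\eta$. For $t=1,\dots,T-1$: call the oracle $L$ times at $X_t$, obtaining $\widehat\nabla_t^{(1)},\dots,\widehat\nabla_t^{(L)}$; set $\widehat\nabla_t=\frac1L\sum_{i=1}^L\widehat\nabla_t^{(i)}$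 and $X_{t+1}=\Pi_{\mathcal{S}_n}[X_t-\eta\widehat\nabla_t]$. Return $\bar X$ by one of: option I: $\bar X=X_{t_0}$ with $t_0$ uniform on $\{1,\dots,T\}$ (independent of everything else); option II: $\bar X=\frac1T\sum_{i=1}^TX_i$. $\tilde O(\cdot)$ hides a universal constant and poly-logarithmic factors (in $n$, $1/\epsilon$ and the problem parameters). *)

theory Defs
  imports
    "HOL-Probability.Probability"
    "HOL-Computational_Algebra.Polynomial"
begin

text \<open>
  Matrices are elements of the Euclidean space \<open>real^'n^'n\<close>, with \<open>n = CARD('n)\<close>. Its library
  inner product is \<open>\<Sum>i j. A$i$j * B$i$j\<close>, that is \<open>Tr (A\<^sup>T B)\<close>, so its \<open>norm\<close> and \<open>dist\<close> are
  those of the Frobenius norm, and \<open>closest_point\<close> is the Frobenius projection.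
\<close>

definition sym_matrices :: "(real^'n^'n) set" where
  "sym_matrices = {A. transpose A = A}"

definition spectrahedron :: "(real^'n^'n) set" where
  "spectrahedron = {X \<in> sym_matrices. (\<forall>v. 0 \<le> v \<bullet> (X *v v)) \<and> trace X = 1}"

definition spectral_norm :: "real^'n^'n \<Rightarrow> real" where
  "spectral_norm A = onorm (\<lambda>v. A *v v)"

text \<open>\<open>mat [:0, 1:]\<close> is \<open>x\<close> times the identity.\<close>

definition charpoly :: "real^'n^'n \<Rightarrow> real poly" where
  "charpoly A = det (mat [:0, 1:] - map_matrix (\<lambda>a. [:a:]) A)"

text \<open>
  The \<open>k\<close>-th largest eigenvalue, counted with multiplicity and with \<open>k\<close> starting at 1. It is
  meaningful for symmetric \<open>A\<close> and \<open>1 \<le> k \<le> CARD('n)\<close>.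
\<close>

definition eigval :: "nat \<Rightarrow> real^'n^'n \<Rightarrow> real" where
  "eigval k A = rev (sorted_list_of_multiset (proots (charpoly A))) ! (k - 1)"

text \<open>
  The objective is a function on the space of symmetric matrices only, so its derivative is taken
  within that subspace, and the gradient is the symmetric matrix representing it. The values of
  \<open>f\<close> and \<open>f'\<close> at other matrices play no role.
\<close>

definition is_gradient :: "(real^'n^'n \<Rightarrow> real) \<Rightarrow> (real^'n^'n \<Rightarrow> real^'n^'n) \<Rightarrow> bool" where
  "is_gradient f f' \<longleftrightarrow>
     (\<forall>X \<in> sym_matrices. f' X \<in> sym_matrices \<and>
        (f has_derivative (\<lambda>H. f' X \<bullet> H)) (at X within sym_matrices))"

text \<open>
  The oracle is a Markov kernel: \<open>orc X\<close> is the conditional law of an answer given that the query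
  is \<open>X\<close>, so conditional expectations given \<open>X\<close> are integrals with respect to \<open>orc X\<close>.
  Measurability is required on the whole matrix space only for convenience; the values of \<open>orc\<close>
  at matrices that are not symmetric play no role.
\<close>

definition stochastic_oracle ::
  "(real^'n^'n \<Rightarrow> (real^'n^'n) measure) \<Rightarrow> (real^'n^'n \<Rightarrow> real^'n^'n) \<Rightarrow>
     real \<Rightarrow> real \<Rightarrow> real \<Rightarrow> bool" where
  "stochastic_oracle orc f' G B \<sigma> \<longleftrightarrow>
     orc \<in> borel \<rightarrow>\<^sub>M prob_algebra borel \<and>
     (\<forall>X \<in> sym_matrices.
        (AE Z in orc X. Z \<in> sym_matrices \<and> norm Z \<le> G \<and> spectral_norm Z \<le> B) \<and>
        has_bochner_integral (orc X) (\<lambda>Z. Z) (f' X) \<and>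
        (LINT Z|orc X. (norm (Z - f' X))\<^sup>2) \<le> \<sigma>\<^sup>2)"

definition minibatch ::
  "(real^'n^'n \<Rightarrow> (real^'n^'n) measure) \<Rightarrow> nat \<Rightarrow> real^'n^'n \<Rightarrow> (real^'n^'n) measure" where
  "minibatch orc L X =
     distr (\<Pi>\<^sub>M i\<in>{..<L}. orc X) borel (\<lambda>Z. (1 / real L) *\<^sub>R (\<Sum>i<L. Z i))"

text \<open>
  \<open>sgd_path orc L \<eta> X\<^sub>1 k\<close> is the joint law of the iterates \<open>x 1, \<dots>, x (Suc k)\<close> of projected SGD
  with mini-batches after \<open>k\<close> steps; the remaining coordinates of \<open>x\<close> still hold the placeholder
  \<open>X\<^sub>1\<close>. Given the past, each step draws a fresh mini-batch that depends on the past through the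
  current iterate only, which is the independence of the oracle calls.
\<close>

primrec sgd_path ::
  "(real^'n^'n \<Rightarrow> (real^'n^'n) measure) \<Rightarrow> nat \<Rightarrow> real \<Rightarrow> real^'n^'n \<Rightarrow> nat \<Rightarrow>
     (nat \<Rightarrow> real^'n^'n) measure" where
  "sgd_path orc L \<eta> X\<^sub>1 0 = return (\<Pi>\<^sub>M i\<in>UNIV. borel) (\<lambda>_. X\<^sub>1)"
| "sgd_path orc L \<eta> X\<^sub>1 (Suc k) =
     sgd_path orc L \<eta> X\<^sub>1 k \<bind> (\<lambda>x.
       distr (minibatch orc L (x (Suc k))) (\<Pi>\<^sub>M i\<in>UNIV. borel)
         (\<lambda>Z. x(Suc (Suc k) := closest_point spectrahedron (x (Suc k) - \<eta> *\<^sub>R Z))))"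

text \<open>The laws of the two possible outputs for horizon \<open>T\<close>, that is for \<open>T - 1\<close> steps.\<close>

definition sgd_random_iterate ::
  "(real^'n^'n \<Rightarrow> (real^'n^'n) measure) \<Rightarrow> nat \<Rightarrow> nat \<Rightarrow> real \<Rightarrow> real^'n^'n \<Rightarrow>
     (real^'n^'n) measure" where
  "sgd_random_iterate orc T L \<eta> X\<^sub>1 =
     distr (sgd_path orc L \<eta> X\<^sub>1 (T - 1) \<Otimes>\<^sub>M measure_pmf (pmf_of_set {1..T})) borel
       (\<lambda>(x, t\<^sub>0). x t\<^sub>0)"

definition sgd_average ::
  "(real^'n^'n \<Rightarrow> (real^'n^'n) measure) \<Rightarrow> nat \<Rightarrow> nat \<Rightarrow> real \<Rightarrow> real^'n^'n \<Rightarrow>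
     (real^'n^'n) measure" where
  "sgd_average orc T L \<eta> X\<^sub>1 =
     distr (sgd_path orc L \<eta> X\<^sub>1 (T - 1)) borel (\<lambda>x. (1 / real T) *\<^sub>R (\<Sum>i=1..T. x i))"

definition warm_radius :: "nat \<Rightarrow> real \<Rightarrow> real \<Rightarrow> real \<Rightarrow> real^'n^'n \<Rightarrow> real" where
  "warm_radius r \<beta> B \<delta> X =
     1/8 * inverse (real r * \<beta> + sqrt (2 * real r) * B / eigval r X) * \<delta>"

definition step_size :: "real \<Rightarrow> real \<Rightarrow> nat \<Rightarrow> real" where
  "step_size R\<^sub>0 G T = R\<^sub>0 / (10 * G * sqrt (real T) * ln (8 * real T))"

definition batch_scale ::
  "nat \<Rightarrow> nat \<Rightarrow> real \<Rightarrow> real \<Rightarrow> real \<Rightarrow> real \<Rightarrow> real \<Rightarrow> nat \<Rightarrow> real" where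
  "batch_scale n r G B \<sigma> \<delta> R\<^sub>0 T =
     max ((\<sigma> / (G * R\<^sub>0))\<^sup>2) (B\<^sup>2 * (real r)\<^sup>2 / \<delta>\<^sup>2 * ln (real n * real T))"

end

theory Submission
  imports Defs "HOL-Real_Asymp.Real_Asymp"
begin

text \<open>
  With \<open>d\<close> the distance of \<open>X\<^sub>1\<close> to the optimum, the classical analysis of projected SGD (nonexpansive
  projection, unbiased answers of norm at most \<open>G\<close>, convexity) bounds the mean optimality gap,
  averaged over the iterates, by \<open>d\<^sup>2 / (2 \<eta> T) + \<eta> G\<^sup>2 / 2\<close>. The warm start \<open>d \<le> R\<^sub>0 / 2\<close> and the
  prescribed step-size turn this into \<open>1.3 R\<^sub>0 G ln (8 T) / sqrt T\<close>, and Markov's inequality gives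
  success probability \<open>1/2\<close> once twice this is at most \<open>\<epsilon>\<close>, that is for \<open>T\<close> of order
  \<open>(R\<^sub>0 G ln (n / \<epsilon>) / \<epsilon>)\<^sup>2\<close>. The product with the batch-size then has the claimed order because
  \<open>\<lambda>\<^sub>r(X\<^sup>*) > 0\<close> forces \<open>R\<^sub>0 B r / \<delta> \<le> \<lambda>\<^sub>r(X\<^sup>*) sqrt r\<close>.
\<close>

section \<open>Eigenvalues of symmetric matrices\<close>

text \<open>A maximizer of the Rayleigh quotient on \<open>S\<close> is an eigenvector.\<close>

lemma selfadjoint_eigenvector:
  fixes f :: "'a::euclidean_space \<Rightarrow> 'a"
  assumes lin: "linear f" and sa: "\<And>x y. f x \<bullet> y = x \<bullet> f y"
    and S: "subspace S" "f ` S \<subseteq> S" "S \<noteq> {0}"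
  obtains v c where "v \<in> S" "norm v = 1" "f v = c *\<^sub>R v"
proof -
  interpret linear f by fact
  let ?K = "S \<inter> sphere 0 1"
  obtain w where w: "w \<in> S" "w \<noteq> 0"
    using S subspace_0 by blast
  then have "w /\<^sub>R norm w \<in> ?K"
    using S by (auto simp: subspace_scale)
  then have ne: "?K \<noteq> {}" by blast
  have "compact ?K"
    using closed_subspace[OF S(1)] by (simp add: closed_Int_compact)
  moreover have "continuous_on ?K (\<lambda>x. f x \<bullet> x)"
    by (intro continuous_intros linear_continuous_on linear_linear[THEN iffD2] lin)
  ultimately obtain v where v: "v \<in> ?K" and max: "\<And>x. x \<in> ?K \<Longrightarrow> f x \<bullet> x \<le> f v \<bullet> v"
    using continuous_attains_sup[of ?K "\<lambda>x. f x \<bullet> x"] ne by blast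
  define m where "m = f v \<bullet> v"
  \<comment> \<open>The quadratic form of \<open>g\<close> is nonnegative on \<open>S\<close>,
    because \<open>m\<close> is the maximum of the Rayleigh quotient, and it vanishes at
    \<open>v\<close>. Perturbing \<open>v\<close> in the direction \<open>g v\<close> will force
    \<open>g v = 0\<close>.\<close>
  define g where "g x = m *\<^sub>R x - f x" for x
  have g_add: "g (x + t *\<^sub>R y) = g x + t *\<^sub>R g y" for x y t
    by (simp only: g_def add scale) (simp add: algebra_simps)
  have g_sa: "g x \<bullet> y = x \<bullet> g y" for x y
    by (simp add: g_def inner_diff_left inner_diff_right sa)
  have g_S: "g x \<in> S" if "x \<in> S" for x
    using that S by (auto simp: g_def intro!: subspace_diff subspace_scale)
  have g_pos: "0 \<le> g x \<bullet> x" if "x \<in> S" for x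
  proof (cases "x = 0")
    case False
    have "x /\<^sub>R norm x \<in> ?K"
      using that False S by (auto simp: subspace_scale)
    from max[OF this] have "f x \<bullet> x \<le> m * (norm x)\<^sup>2"
      using False by (simp add: scale m_def field_simps power2_eq_square)
    then show ?thesis
      by (simp add: g_def inner_diff_left dot_square_norm)
  qed simp
  have nv: "norm v = 1" "v \<in> S" using v by auto
  have gv0: "g v \<bullet> v = 0"
    using nv by (simp add: g_def inner_diff_left m_def dot_square_norm)
  define p where "p = g v \<bullet> g v"
  define q where "q = g (g v) \<bullet> g v"
  have q: "0 \<le> q" unfolding q_def using g_pos g_S nv by blast
  \<comment> \<open>a positive semidefinite form that vanishes at \<open>v\<close> has \<open>v\<close> in its kernel\<close>
  have quad: "0 \<le> 2 * t * p + t\<^sup>2 * q" for t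
  proof -
    have "0 \<le> g (v + t *\<^sub>R g v) \<bullet> (v + t *\<^sub>R g v)"
      using S nv g_S by (intro g_pos) (auto intro!: subspace_add subspace_scale)
    also have "\<dots> = 2 * t * p + t\<^sup>2 * q"
      unfolding g_add p_def q_def using gv0
      by (simp add: algebra_simps inner_add_left inner_add_right power2_eq_square g_sa)
    finally show ?thesis .
  qed
  have "p = 0"
  proof (rule ccontr)
    assume "p \<noteq> 0"
    then have p: "p > 0" by (simp add: p_def)
    \<comment> \<open>At \<open>t = - e\<close> the linear term beats the quadratic one. The
      \<open>+ 1\<close> keeps the denominator positive when \<open>q = 0\<close>.\<close>
    define e where "e = p / (q + 1)"
    have e: "0 < e" "p = e * (q + 1)" using p q by (auto simp: e_def)
    have "2 * (- e) * p + (- e)\<^sup>2 * q = - (e\<^sup>2 * (q + 2))"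
      by (simp add: e(2) algebra_simps power2_eq_square)
    also have "\<dots> < 0" using e(1) q by simp
    finally show False using quad[of "- e"] by linarith
  qed
  then have "f v = m *\<^sub>R v" by (simp add: p_def g_def)
  with nv that show ?thesis by blast
qed

text \<open>Induction on the dimension: split off one unit eigenvector \<open>v\<close>. By
  self-adjointness the part of \<open>S\<close> orthogonal to \<open>v\<close> is again invariant,
  and its dimension is one less.\<close>

lemma selfadjoint_orthonormal_eigenbasis:
  fixes f :: "'a::euclidean_space \<Rightarrow> 'a"
  assumes lin: "linear f" and sa: "\<And>x y. f x \<bullet> y = x \<bullet> f y"
    and S: "subspace S" "f ` S \<subseteq> S"
  shows "\<exists>B\<subseteq>S. finite B \<and> card B = dim S \<and> pairwise orthogonal B \<and> (\<forall>v\<in>B. norm v = 1) \<and>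
           (\<forall>v\<in>B. \<exists>c. f v = c *\<^sub>R v)"
  using S
proof (induction "dim S" arbitrary: S)
  case 0
  then show ?case by (intro exI[of _ "{}"]) auto
next
  case (Suc k)
  then have "S \<noteq> {0}" by auto
  from selfadjoint_eigenvector[OF lin sa Suc.prems this]
  obtain v c where v: "v \<in> S" "norm v = 1" "f v = c *\<^sub>R v" by blast
  define S' where "S' = {y \<in> S. orthogonal v y}"
  have sub: "subspace S'"
    using Suc.prems(1) unfolding S'_def orthogonal_def
    by (auto simp: subspace_def inner_add_right)
  have inv: "f ` S' \<subseteq> S'"
    using Suc.prems(2) unfolding S'_def orthogonal_def
    by (auto simp: sa[symmetric] v(3))
  have eq: "{y \<in> S. \<forall>x\<in>span {v}. orthogonal x y} = S'"
    by (auto simp: S'_def span_singleton orthogonal_def)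
  have "dim {y \<in> S. \<forall>x\<in>span {v}. orthogonal x y} + dim (span {v}) = dim S"
    using v Suc.prems(1) by (intro dim_subspace_orthogonal_to_vectors) (auto simp: span_minimal)
  then have "k = dim S'"
    using Suc.hyps(2) v(2) eq by (auto simp: dim_singleton split: if_splits)
  from Suc.hyps(1)[OF this sub inv] obtain B where B: "B \<subseteq> S'" "finite B" "card B = dim S'"
    "pairwise orthogonal B" "\<forall>v\<in>B. norm v = 1" "\<forall>v\<in>B. \<exists>c. f v = c *\<^sub>R v" by blast
  have "v \<notin> B" using B(1) v(2) by (auto simp: S'_def orthogonal_def)
  then show ?case
    using B v \<open>k = dim S'\<close> Suc.hyps(2)
    by (intro exI[of _ "insert v B"])
       (auto simp: S'_def pairwise_insert orthogonal_commute)
qed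

lemma symmetric_diagonalization:
  fixes A :: "real^'n^'n"
  assumes "transpose A = A"
  obtains v :: "'n \<Rightarrow> real^'n" and d
  where "\<And>i j. v i \<bullet> v j = (if i = j then 1 else 0)" "\<And>i. A *v v i = d i *\<^sub>R v i"
proof -
  have "(A *v x) \<bullet> y = x \<bullet> (A *v y)" for x y
    
    using assms dot_lmul_matrix[of x A y] vector_transpose_matrix[of x A] by simp
  from selfadjoint_orthonormal_eigenbasis[OF matrix_vector_mul_linear[of A] this, of UNIV]
  obtain B where B: "finite B" "card B = DIM(real^'n)" "pairwise orthogonal B"
    "\<forall>v\<in>B. norm v = 1" "\<forall>v\<in>B. \<exists>c. A *v v = c *\<^sub>R v"
    by (auto simp: dim_UNIV)
  \<comment> \<open>The basis has as many members as the index type, so it can be indexed by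
    \<open>'n\<close> itself; no order of the eigenvalues is fixed.\<close>
  have "card (UNIV :: 'n set) = card B" using B(2) by simp
  then obtain v :: "'n \<Rightarrow> real^'n" where v: "bij_betw v UNIV B"
    using bij_betw_iff_card[of "UNIV :: 'n set" B] B(1) by auto
  have vB: "v i \<in> B" for i using v by (auto simp: bij_betw_def)
  have inj: "v i \<noteq> v j" if "i \<noteq> j" for i j using v that by (auto simp: bij_betw_def inj_def)
  have orth: "v i \<bullet> v j = (if i = j then 1 else 0)" for i j
    using B(3,4) vB inj by (auto simp: pairwise_def orthogonal_def dot_square_norm)
  have "\<forall>i. \<exists>c. A *v v i = c *\<^sub>R v i" using B(5) vB by blast
  then obtain d where d: "\<And>i. A *v v i = d i *\<^sub>R v i" by metis
  show ?thesis by (rule that[OF orth d])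
qed

lemma poly_det: "poly (det M) x = det (map_matrix (\<lambda>p. poly p x) M)"
  by (simp add: det_def poly_sum poly_prod map_matrix_def of_int_poly)

text \<open>Conjugation with the orthogonal matrix \<open>P\<close> of eigenvectors makes
  \<open>mat x - A\<close> diagonal and keeps its determinant. Doing this for each real
  \<open>x\<close> suffices, since a real polynomial is determined by its values, and it avoids
  matrices of polynomials.\<close>

lemma charpoly_diagonalization:
  fixes A :: "real^'n^'n" and v :: "'n \<Rightarrow> real^'n"
  assumes v: "\<And>i j. v i \<bullet> v j = (if i = j then 1 else 0)" "\<And>i. A *v v i = d i *\<^sub>R v i"
  shows "charpoly A = (\<Prod>i\<in>UNIV. [:- d i, 1:])"
proof (rule poly_eq_poly_eq_iff[THEN iffD1], rule ext)
  fix x :: real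
  define P :: "real^'n^'n" where "P = (\<chi> i j. v j $ i)"
  define M where "M = mat x - A"
  have M: "map_matrix (\<lambda>p. poly p x) (mat [:0, 1:] - map_matrix (\<lambda>a. [:a:]) A) = M"
    by (simp add: vec_eq_iff map_matrix_def mat_def M_def)
  have PP: "transpose P ** P = mat 1"
    using v(1) by (simp add: vec_eq_iff matrix_matrix_mult_def transpose_def P_def mat_def inner_vec_def)
  have Mv: "M *v v i = (x - d i) *\<^sub>R v i" for i
    by (simp add: M_def matrix_vector_mult_diff_rdistrib v(2) scaleR_diff_left)
       (simp add: vec_eq_iff mat_def matrix_vector_mult_def if_distrib if_distribR cong: if_cong)
  have "(transpose P ** (M ** P)) $ i $ j = v i \<bullet> (M *v v j)" for i j
    by (simp add: matrix_matrix_mult_def transpose_def P_def matrix_vector_mult_def inner_vec_def)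
  then have D: "(transpose P ** (M ** P)) $ i $ j = (if i = j then x - d i else 0)" for i j
    by (simp add: Mv v(1))
  have "poly (charpoly A) x = det M"
    by (simp add: charpoly_def poly_det M)
  also have "det M = det (transpose P) * (det M * det P)"
    using arg_cong[OF PP, of det] by (simp add: det_mul)
  also have "\<dots> = det (transpose P ** (M ** P))" by (simp add: det_mul)
  also have "\<dots> = (\<Prod>i\<in>UNIV. x - d i)"
    by (subst det_diagonal) (auto simp: D)
  also have "\<dots> = poly (\<Prod>i\<in>UNIV. [:- d i, 1:]) x"
    by (simp add: poly_prod)
  finally show "poly (charpoly A) x = poly (\<Prod>i\<in>UNIV. [:- d i, 1:]) x" .
qed

text \<open>In a decreasing list, an entry at position \<open>k - 1\<close> that is not positive
  confines the positive entries to the first \<open>k - 1\<close> places, which are too few.\<close>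

lemma rev_sorted_nth_pos:
  fixes M :: "real multiset"
  assumes "k \<le> size (filter_mset (\<lambda>x. 0 < x) M)" "1 \<le> k"
  shows "0 < rev (sorted_list_of_multiset M) ! (k - 1)"
proof (rule ccontr)
  define ys where "ys = rev (sorted_list_of_multiset M)"
  assume "\<not> ?thesis"
  then have le: "ys ! (k - 1) \<le> 0" by (simp add: ys_def)
  have srt: "sorted (rev ys)" by (simp add: ys_def)
  have [simp]: "mset ys = M" by (simp add: ys_def)
  have len: "length (filter (\<lambda>x. 0 < x) ys) = size (filter_mset (\<lambda>x. 0 < x) M)"
    by (metis \<open>mset ys = M\<close> mset_filter size_mset)
  have drop: "filter (\<lambda>x. 0 < x) (drop (k - 1) ys) = []"
  proof (clarsimp simp: filter_empty_conv in_set_conv_nth not_less)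
    fix i assume i: "i < length ys - (k - Suc 0)"
    then have "ys ! (k - Suc 0 + i) \<le> ys ! (k - Suc 0)"
      using srt by (intro sorted_rev_nth_mono) auto
    then show "ys ! (k - Suc 0 + i) \<le> 0" using le by simp
  qed
  have "filter (\<lambda>x. 0 < x) ys = filter (\<lambda>x. 0 < x) (take (k - 1) ys @ drop (k - 1) ys)"
    by simp
  also have "\<dots> = filter (\<lambda>x. 0 < x) (take (k - 1) ys)"
    using drop by (simp only: filter_append) simp
  finally have "length (filter (\<lambda>x. 0 < x) ys) \<le> length (take (k - 1) ys)"
    by (metis length_filter_le)
  also have "\<dots> \<le> k - 1" by simp
  finally show False using len assms by simp
qed

text \<open>Makes the eigenvalue that divides in \<open>warm_radius\<close> positive. The range of
  \<open>A\<close> lies in the span of the eigenvectors with positive eigenvalue, so at least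
  \<open>rank A\<close> roots of the characteristic polynomial are positive.\<close>

lemma eigval_rank_pos:
  fixes A :: "real^'n^'n"
  assumes sym: "transpose A = A" and psd: "\<And>v. 0 \<le> v \<bullet> (A *v v)" and rank: "1 \<le> rank A"
  shows "0 < eigval (rank A) A"
proof -
  obtain v d where v: "\<And>i j. v i \<bullet> v j = (if i = j then 1 else 0)" and
    Av: "\<And>i::'n. A *v v i = d i *\<^sub>R v i" using symmetric_diagonalization[OF sym] by blast
  have d: "0 \<le> d i" for i using psd[of "v i"] by (simp add: Av v)
  define J where "J = {i. 0 < d i}"
  have indep: "independent (range v)"
    by (rule pairwise_orthogonal_independent)
       (auto simp: pairwise_def orthogonal_def v, metis inner_zero_left v zero_neq_one)
  have "inj v" by (rule injI) (metis v zero_neq_one)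
  then have "card (range v) = DIM(real^'n)" by (simp add: card_image)
  then have span: "span (range v) = UNIV"
    using card_ge_dim_independent[OF subset_UNIV indep] by (auto simp: dim_UNIV)
  have "range (\<lambda>x. A *v x) = (\<lambda>x. A *v x) ` span (range v)" by (simp add: span)
  also have "\<dots> = span ((\<lambda>x. A *v x) ` range v)"
    by (simp add: linear_span_image)
  also have "\<dots> \<subseteq> span (v ` J)"
  proof (rule span_minimal)
    show "(\<lambda>x. A *v x) ` range v \<subseteq> span (v ` J)"
    proof (clarsimp simp: Av)
      fix i show "d i *\<^sub>R v i \<in> span (v ` J)"
      proof (cases "d i = 0")
        case False
        then have "v i \<in> v ` J" using d[of i] by (simp add: J_def)
        then show ?thesis by (intro span_scale span_base)
      qed (simp add: span_zero)
    qed
  qed simp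
  finally have "rank A \<le> dim (span (v ` J))"
    unfolding rank_dim_range by (rule dim_subset)
  also have "\<dots> \<le> card (v ` J)" by (simp add: dim_le_card')
  also have "\<dots> \<le> card J" by (simp add: card_image_le)
  finally have "rank A \<le> card J" .
  \<comment> \<open>Multiplicities survive: \<open>proots\<close> contains \<open>d i\<close> once
    for every index \<open>i\<close>.\<close>
  moreover have "proots (charpoly A) = image_mset d (mset_set UNIV)"
    by (subst charpoly_diagonalization[OF v Av], subst proots_prod) (auto simp: sum_unfold_sum_mset)
  then have "size (filter_mset (\<lambda>x. 0 < x) (proots (charpoly A))) = card J"
    by (simp add: filter_mset_image_mset J_def filter_mset_mset_set)
  ultimately show ?thesis
    unfolding eigval_def using rank by (intro rev_sorted_nth_pos) auto
qed

section \<open>Convexity on the spectrahedron\<close>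

lemma subspace_sym_matrices: "subspace (sym_matrices :: (real^'n^'n) set)"
  by (auto simp: subspace_def sym_matrices_def transpose_def vec_eq_iff)

lemma spectrahedron_subset_sym: "spectrahedron \<subseteq> sym_matrices"
  by (auto simp: spectrahedron_def)

lemma convex_spectrahedron: "convex (spectrahedron :: (real^'n^'n) set)"
  unfolding convex_def
proof (intro ballI allI impI)
  fix X Y :: "real^'n^'n" and u v :: real
  assume *: "X \<in> spectrahedron" "Y \<in> spectrahedron" "0 \<le> u" "0 \<le> v" "u + v = 1"
  have "u *\<^sub>R X + v *\<^sub>R Y \<in> sym_matrices"
    using * spectrahedron_subset_sym subspace_sym_matrices
    by (auto intro!: subspace_add subspace_scale)
  moreover have "trace (u *\<^sub>R X + v *\<^sub>R Y) = u * trace X + v * trace Y"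
    by (simp add: trace_def sum.distrib sum_distrib_left)
  moreover have "(u *\<^sub>R X + v *\<^sub>R Y) *v w = u *\<^sub>R (X *v w) + v *\<^sub>R (Y *v w)" for w
    by (simp add: matrix_vector_mult_add_rdistrib scaleR_matrix_vector_assoc)
  ultimately show "u *\<^sub>R X + v *\<^sub>R Y \<in> spectrahedron"
    using * by (auto simp: spectrahedron_def inner_add_right)
qed

lemma closed_spectrahedron: "closed (spectrahedron :: (real^'n^'n) set)"
proof -
  have 1: "closed (sym_matrices :: (real^'n^'n) set)"
    by (rule closed_subspace[OF subspace_sym_matrices])
  have 2: "closed {X :: real^'n^'n. 0 \<le> v \<bullet> (X *v v)}" for v
    unfolding matrix_vector_mult_def inner_vec_def
    by (intro closed_Collect_le continuous_intros) 
  have 3: "closed {X :: real^'n^'n. trace X = 1}"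
    unfolding trace_def by (intro closed_Collect_eq continuous_intros)
  have eq: "spectrahedron = sym_matrices \<inter> (\<Inter>v. {X :: real^'n^'n. 0 \<le> v \<bullet> (X *v v)}) \<inter> {X. trace X = 1}"
    by (auto simp: spectrahedron_def)
  show ?thesis unfolding eq using 1 2 3 by (intro closed_Int closed_INT) auto
qed

text \<open>Reduction to one real variable on the line through \<open>X\<close> and
  \<open>Y\<close>. That line stays in the subspace of symmetric matrices, where convexity is
  assumed and the derivative is taken.\<close>

lemma is_gradient_above_tangent:
  assumes conv: "convex_on sym_matrices f" and grad: "is_gradient f f'"
    and X: "X \<in> sym_matrices" and Y: "Y \<in> sym_matrices"
  shows "f X + f' X \<bullet> (Y - X) \<le> f Y"
proof -
  define g where "g t = X + t *\<^sub>R (Y - X)" for t :: real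
  have gs: "g t \<in> sym_matrices" for t
    unfolding g_def using X Y subspace_sym_matrices
    by (intro subspace_add subspace_scale subspace_diff)
  have "convex_on UNIV (f \<circ> g)"
  proof (rule convex_onI)
    fix t x y :: real assume t: "0 < t" "t < 1"
    have "g ((1 - t) *\<^sub>R x + t *\<^sub>R y) = (1 - t) *\<^sub>R g x + t *\<^sub>R g y"
      by (simp add: g_def algebra_simps)
    then show "(f \<circ> g) ((1 - t) *\<^sub>R x + t *\<^sub>R y) \<le> (1 - t) * (f \<circ> g) x + t * (f \<circ> g) y"
      using convex_onD[OF conv, of t "g x" "g y"] gs t by simp
  qed simp
  moreover have "((f \<circ> g) has_real_derivative f' X \<bullet> (Y - X)) (at 0)"
  proof -
    have 1: "(g has_derivative (\<lambda>t. t *\<^sub>R (Y - X))) (at 0)"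
      unfolding g_def by (auto intro!: derivative_eq_intros)
    have "(f has_derivative (\<lambda>H. f' X \<bullet> H)) (at X within sym_matrices)"
      using grad X by (simp add: is_gradient_def)
    \<comment> \<open>Differentiability within \<open>sym_matrices\<close> restricts to the line,
      and as the whole line is available the derivative of \<open>f \<circ> g\<close> at 0 is
      two-sided.\<close>
    moreover have "range g \<subseteq> sym_matrices" using gs by blast
    ultimately have "(f has_derivative (\<lambda>H. f' X \<bullet> H)) (at X within range g)"
      by (rule has_derivative_subset)
    then have 2: "(f has_derivative (\<lambda>H. f' X \<bullet> H)) (at (g 0) within range g)"
      by (simp add: g_def)
    have "((f \<circ> g) has_derivative (\<lambda>H. f' X \<bullet> H) \<circ> (\<lambda>t. t *\<^sub>R (Y - X))) (at 0)"
      using diff_chain_within[OF 1 2] by simp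
    then show ?thesis
      by (simp add: has_field_derivative_def o_def mult_commute_abs)
  qed
  ultimately have "f' X \<bullet> (Y - X) * (1 - 0) \<le> (f \<circ> g) 1 - (f \<circ> g) 0"
    by (intro convex_on_imp_above_tangent[where A = UNIV and f = "f \<circ> g"]) simp_all
  then show ?thesis by (simp add: g_def)
qed

lemma is_gradient_continuous_on:
  "is_gradient f f' \<Longrightarrow> continuous_on sym_matrices f"
  unfolding is_gradient_def continuous_on_eq_continuous_within
  using has_derivative_continuous by blast

section \<open>Mini-batches\<close>

text \<open>Boxes form an intersection-stable generator of the product \<sigma>-algebra, and the
  measure of a box is a finite product of measurable functions of the parameter.\<close>

lemma measurable_PiM_kernel:
  assumes K: "\<And>i. i \<in> I \<Longrightarrow> K i \<in> M \<rightarrow>\<^sub>M prob_algebra (N i)" and I: "finite I"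
  shows "(\<lambda>x. \<Pi>\<^sub>M i\<in>I. K i x) \<in> M \<rightarrow>\<^sub>M prob_algebra (\<Pi>\<^sub>M i\<in>I. N i)"
proof (rule measurable_prob_algebra_generated[OF sets_PiM Int_stable_prod_algebra prod_algebra_sets_into_space])
  fix a assume a: "a \<in> space M"
  have K': "prob_space (K i a)" "sets (K i a) = sets (N i)" if "i \<in> I" for i
    using measurable_space[OF K[OF that] a] by (auto simp: space_prob_algebra)
  show "prob_space (\<Pi>\<^sub>M i\<in>I. K i a)" using K' by (intro prob_space_PiM)
  show "sets (\<Pi>\<^sub>M i\<in>I. K i a) = sets (\<Pi>\<^sub>M i\<in>I. N i)" using K' by (intro sets_PiM_cong) auto
next
  fix A assume "A \<in> prod_algebra I N"
  then obtain E where E: "A = Pi\<^sub>E I E" "\<And>i. i \<in> I \<Longrightarrow> E i \<in> sets (N i)"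
    using I by (auto simp: prod_algebra_eq_finite)
  have "emeasure (\<Pi>\<^sub>M i\<in>I. K i a) A = (\<Prod>i\<in>I. emeasure (K i a) (E i))" if a: "a \<in> space M" for a
  proof -
    have K': "prob_space (K i a)" "sets (K i a) = sets (N i)" if "i \<in> I" for i
      using measurable_space[OF K[OF that] a] by (auto simp: space_prob_algebra)
    \<comment> \<open>\<open>product_prob_space\<close> needs probability measures outside \<open>I\<close>, too\<close>
    define K1 where "K1 i = (if i \<in> I then K i a else return (count_space UNIV) undefined)" for i
    interpret product_prob_space K1 I
      using K' by (intro product_prob_spaceI) (simp add: K1_def prob_space_return)
    have "PiM I (\<lambda>i. K i a) = PiM I K1" by (intro PiM_cong) (auto simp: K1_def)
    then show ?thesis
      using emeasure_PiM[of I E] I E K' by (simp add: K1_def)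
  qed
  moreover have "(\<lambda>a. \<Prod>i\<in>I. emeasure (K i a) (E i)) \<in> borel_measurable M"
    using E(2) by (intro borel_measurable_prod_ennreal measurable_compose[OF measurable_prob_algebraD[OF K]]
        measurable_emeasure_subprob_algebra)
  ultimately show "(\<lambda>a. emeasure (\<Pi>\<^sub>M i\<in>I. K i a) A) \<in> borel_measurable M"
    by (simp cong: measurable_cong)
qed

lemma measurable_minibatch:
  assumes "orc \<in> borel \<rightarrow>\<^sub>M prob_algebra borel"
  shows "minibatch orc L \<in> borel \<rightarrow>\<^sub>M prob_algebra borel"
proof -
  have "(\<lambda>Z. (1 / real L) *\<^sub>R (\<Sum>i<L. Z i)) \<in> (\<Pi>\<^sub>M i\<in>{..<L}. borel) \<rightarrow>\<^sub>M (borel :: (real^'n^'n) measure)"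
    by measurable
  from measurable_compose[OF measurable_PiM_kernel measurable_distr_prob_space[OF this], of "\<lambda>_. orc"]
  show ?thesis using assms by (simp add: minibatch_def[abs_def])
qed

text \<open>Each coordinate of the product has law \<open>orc X\<close>, so the norm bound and the
  mean pass to the average by the triangle inequality and linearity. \<open>L \<ge> 1\<close> makes
  the weights \<open>1 / real L\<close> sum to 1.\<close>

lemma minibatch_law:
  assumes orc: "stochastic_oracle orc f' G B \<sigma>" and X: "X \<in> sym_matrices" and L: "L \<ge> 1"
  shows "prob_space (minibatch orc L X)" "sets (minibatch orc L X) = sets borel"
    and "AE Z in minibatch orc L X. norm Z \<le> G"
    and "has_bochner_integral (minibatch orc L X) (\<lambda>Z. Z) (f' X)"
proof -
  have mo: "orc \<in> borel \<rightarrow>\<^sub>M prob_algebra borel" using orc by (simp add: stochastic_oracle_def)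
  have oX: "prob_space (orc X)" "sets (orc X) = sets borel"
    using measurable_space[OF mo, of X] by (auto simp: space_prob_algebra)
  show "prob_space (minibatch orc L X)" "sets (minibatch orc L X) = sets borel"
    using measurable_space[OF measurable_minibatch[OF mo], of X] by (auto simp: space_prob_algebra)
  let ?P = "\<Pi>\<^sub>M i\<in>{..<L}. orc X"
  let ?a = "\<lambda>Z :: nat \<Rightarrow> real^'n^'n. (1 / real L) *\<^sub>R (\<Sum>i<L. Z i)"
  have comp: "distr ?P (orc X) (\<lambda>\<omega>. \<omega> i) = orc X" if "i < L" for i
    using that oX by (intro distr_PiM_component) auto
  have mc: "(\<lambda>\<omega>. \<omega> i) \<in> borel_measurable ?P" if "i < L" for i
    using measurable_component_singleton[of i "{..<L}" "\<lambda>_. orc X"] that oX(2) 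
    by (simp cong: measurable_cong_sets)
  have ma: "?a \<in> borel_measurable ?P" using mc by measurable
  have AEo: "AE Z in orc X. norm Z \<le> G" using orc X by (auto simp: stochastic_oracle_def)
  have AEi: "AE \<omega> in ?P. norm (\<omega> i) \<le> G" if i: "i < L" for i
  proof -
    have "AE Z in distr ?P (orc X) (\<lambda>\<omega>. \<omega> i). norm Z \<le> G" unfolding comp[OF i] by (rule AEo)
    with i show ?thesis
      by (intro AE_distrD[OF measurable_component_singleton[of i "{..<L}" "\<lambda>_. orc X"]]) simp_all
  qed
  have "AE \<omega> in ?P. \<forall>i\<in>{..<L}. norm (\<omega> i) \<le> G"
    using AEi by (intro AE_finite_allI) auto
  then have "AE \<omega> in ?P. norm (?a \<omega>) \<le> G"
  proof eventually_elim
    fix \<omega> :: "nat \<Rightarrow> real^'n^'n" assume "\<forall>i\<in>{..<L}. norm (\<omega> i) \<le> G"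
    then have "norm (\<Sum>i<L. \<omega> i) \<le> real L * G"
      using sum_norm_bound[of "{..<L}" \<omega> G] by simp
    then show "norm (?a \<omega>) \<le> G" using L by (simp add: field_simps)
  qed
  then show "AE Z in minibatch orc L X. norm Z \<le> G"
    unfolding minibatch_def using ma by (subst AE_distr_iff) auto
  have hb: "has_bochner_integral ?P (\<lambda>\<omega>. \<omega> i) (f' X)" if i: "i < L" for i
  proof -
    have "has_bochner_integral (orc X) (\<lambda>Z. Z) (f' X)" using orc X by (auto simp: stochastic_oracle_def)
    then have "has_bochner_integral (distr ?P (orc X) (\<lambda>\<omega>. \<omega> i)) (\<lambda>Z. Z) (f' X)"
      using comp[OF i] by simp
    moreover have "(\<lambda>Z. Z) \<in> borel_measurable (orc X)"
      using oX(2) by (simp add: measurable_ident_sets)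
    moreover have "(\<lambda>\<omega>. \<omega> i) \<in> ?P \<rightarrow>\<^sub>M orc X"
      using i by (intro measurable_component_singleton) simp
    ultimately show ?thesis
      by (simp add: has_bochner_integral_iff integrable_distr_eq integral_distr)
  qed
  have "has_bochner_integral ?P ?a ((1 / real L) *\<^sub>R (\<Sum>i<L. f' X))"
    using hb by (intro has_bochner_integral_scaleR_right has_bochner_integral_sum) auto
  then have "has_bochner_integral ?P ?a (f' X)" using L by (simp add: sum_constant_scaleR del: sum_constant)
  then show "has_bochner_integral (minibatch orc L X) (\<lambda>Z. Z) (f' X)"
    unfolding minibatch_def using ma
    by (intro has_bochner_integral_distr) simp_all
qed

section \<open>Projected SGD\<close>

locale projected_sgd =
  fixes f :: "real^'n^'n \<Rightarrow> real"
    and f' :: "real^'n^'n \<Rightarrow> real^'n^'n"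
    and orc :: "real^'n^'n \<Rightarrow> (real^'n^'n) measure"
    and Xopt X\<^sub>1 :: "real^'n^'n"
    and G B \<sigma> \<eta> :: real and L :: nat
  assumes cvx: "convex_on sym_matrices f"
    and grad: "is_gradient f f'"
    and stoch: "stochastic_oracle orc f' G B \<sigma>"
    and minimizer: "is_arg_min f (\<lambda>X. X \<in> spectrahedron) Xopt"
    and start: "X\<^sub>1 \<in> spectrahedron"
    and step: "0 < \<eta>"
    and batch: "1 \<le> L"
begin

text \<open>\<open>f\<close> is controlled on symmetric matrices only. The cut-off outside the
  spectrahedron makes the gap Borel measurable and nonnegative on the whole matrix space.\<close>

definition gap :: "real^'n^'n \<Rightarrow> real" where
  "gap X = indicator spectrahedron X *\<^sub>R (f X - f Xopt)"

abbreviation "mb \<equiv> minibatch orc L"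
abbreviation update :: "real^'n^'n \<Rightarrow> real^'n^'n \<Rightarrow> real^'n^'n" where
  "update X Z \<equiv> closest_point spectrahedron (X - \<eta> *\<^sub>R Z)"
abbreviation "trajectory \<equiv> sgd_path orc L \<eta> X\<^sub>1"
abbreviation "paths \<equiv> (\<Pi>\<^sub>M i\<in>(UNIV :: nat set). (borel :: (real^'n^'n) measure))"

lemma Xopt_mem: "Xopt \<in> spectrahedron"
  using minimizer by (simp add: is_arg_min_def)

lemma f_Xopt_le: "X \<in> spectrahedron \<Longrightarrow> f Xopt \<le> f X"
  using minimizer by (auto simp: is_arg_min_def not_less)

lemma gap_nonneg: "0 \<le> gap X"
  by (auto simp: gap_def indicator_def f_Xopt_le)

lemma continuous_on_f: "continuous_on spectrahedron f"
  using is_gradient_continuous_on[OF grad] spectrahedron_subset_sym continuous_on_subset by blast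

lemma spectrahedron_sets [measurable]: "(spectrahedron :: (real^'n^'n) set) \<in> sets borel"
  by (rule borel_closed[OF closed_spectrahedron])

lemma measurable_gap [measurable]: "gap \<in> borel_measurable borel"
  unfolding gap_def
  by (intro borel_measurable_continuous_on_indicator continuous_intros continuous_on_f spectrahedron_sets)

lemma measurable_ennreal_gap: "(\<lambda>X. ennreal (gap X)) \<in> borel_measurable borel"
  by measurable

lemma measurable_proj [measurable]: "closest_point spectrahedron \<in> borel \<rightarrow>\<^sub>M (borel :: (real^'n^'n) measure)"
  using Xopt_mem by (intro borel_measurable_continuous_onI continuous_on_closest_point
      convex_spectrahedron closed_spectrahedron) auto

lemma update_mem: "update X Z \<in> spectrahedron"
  by (rule closest_point_in_set[OF closed_spectrahedron]) (use Xopt_mem in blast)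

text \<open>The projection is nonexpansive and fixes \<open>Xopt\<close>.\<close>

lemma update_dist: "norm (update X Z - Xopt) \<le> norm (X - \<eta> *\<^sub>R Z - Xopt)"
  using closest_point_lipschitz[OF convex_spectrahedron closed_spectrahedron, of "X - \<eta> *\<^sub>R Z" Xopt]
    Xopt_mem closest_point_self[OF Xopt_mem] by (auto simp: dist_norm)

lemma measurable_mb [measurable]: "mb \<in> borel \<rightarrow>\<^sub>M prob_algebra borel"
  using stoch by (intro measurable_minibatch) (simp add: stochastic_oracle_def)

text \<open>Expand the square, take the mean over the mini-batch, and bound the cross term by
  convexity. The gap stands on the left to avoid subtraction of extended nonnegative reals.\<close>

lemma step_bound:
  assumes X: "X \<in> spectrahedron"
  shows "(\<integral>\<^sup>+Z. ennreal ((norm (update X Z - Xopt))\<^sup>2) \<partial>mb X) + ennreal (2 * \<eta> * gap X)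
    \<le> ennreal ((norm (X - Xopt))\<^sup>2 + \<eta>\<^sup>2 * G\<^sup>2)"
proof -
  have Xs: "X \<in> sym_matrices" "Xopt \<in> sym_matrices"
    using X Xopt_mem spectrahedron_subset_sym by auto
  note mb = minibatch_law[OF stoch Xs(1) batch]
  interpret prob_space "mb X" by (rule mb)
  \<comment> \<open>\<open>u\<close> is the expanded square with \<open>norm Z\<close> replaced by
    its bound \<open>G\<close>. It is affine in \<open>Z\<close>, so unbiasedness gives its mean
    exactly.\<close>
  define u :: "real^'n^'n \<Rightarrow> real" where "u Z = (norm (X - Xopt))\<^sup>2 + \<eta>\<^sup>2 * G\<^sup>2 - 2 * \<eta> * (Z \<bullet> (X - Xopt))" for Z
  have le: "AE Z in mb X. (norm (update X Z - Xopt))\<^sup>2 \<le> u Z"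
    using mb(3)
  proof eventually_elim
    fix Z :: "real^'n^'n" assume Z: "norm Z \<le> G"
    have "(norm (update X Z - Xopt))\<^sup>2 \<le> (norm (X - \<eta> *\<^sub>R Z - Xopt))\<^sup>2"
      using update_dist by (intro power_mono) auto
    also have "\<dots> = (norm (X - Xopt))\<^sup>2 - 2 * \<eta> * (Z \<bullet> (X - Xopt)) + \<eta>\<^sup>2 * (norm Z)\<^sup>2"
      unfolding power2_norm_eq_inner
      by (simp add: algebra_simps inner_commute power2_eq_square)
    also have "\<dots> \<le> u Z"
      using Z by (simp add: u_def power_mono mult_left_mono)
    finally show "(norm (update X Z - Xopt))\<^sup>2 \<le> u Z" .
  qed
  \<comment> \<open>Nonnegativity of \<open>u\<close> lets its nonnegative integral be read off from
    the Bochner integral.\<close>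
  then have u0: "AE Z in mb X. 0 \<le> u Z"
    by eventually_elim (metis order_trans zero_le_power2)
  have "has_bochner_integral (mb X) (\<lambda>Z. Z \<bullet> (X - Xopt)) (f' X \<bullet> (X - Xopt))"
    using mb(4) by (rule has_bochner_integral_inner_left)
  then have int: "integrable (mb X) u" "integral\<^sup>L (mb X) u =
      (norm (X - Xopt))\<^sup>2 + \<eta>\<^sup>2 * G\<^sup>2 - 2 * \<eta> * (f' X \<bullet> (X - Xopt))"
    unfolding u_def[abs_def] by (auto simp: has_bochner_integral_iff prob_space)
  have nonneg: "0 \<le> integral\<^sup>L (mb X) u" using u0 by (rule integral_nonneg_AE)
  \<comment> \<open>The tangent at \<open>X\<close>, evaluated at \<open>Xopt\<close>, bounds the
    gap by the mean cross term.\<close>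
  have "f X + f' X \<bullet> (Xopt - X) \<le> f Xopt"
    by (rule is_gradient_above_tangent[OF cvx grad Xs])
  then have "gap X \<le> f' X \<bullet> (X - Xopt)"
    using X by (simp add: gap_def inner_diff_right)
  then have gap: "2 * \<eta> * gap X \<le> 2 * \<eta> * (f' X \<bullet> (X - Xopt))"
    using step by simp
  have "(\<integral>\<^sup>+Z. ennreal ((norm (update X Z - Xopt))\<^sup>2) \<partial>mb X) \<le> (\<integral>\<^sup>+Z. ennreal (u Z) \<partial>mb X)"
    using le by (intro nn_integral_mono_AE) (auto elim!: eventually_mono intro: ennreal_leI)
  also have "\<dots> = ennreal (integral\<^sup>L (mb X) u)"
    using int(1) u0 by (rule nn_integral_eq_integral)
  finally have "(\<integral>\<^sup>+Z. ennreal ((norm (update X Z - Xopt))\<^sup>2) \<partial>mb X) + ennreal (2 * \<eta> * gap X)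
      \<le> ennreal (integral\<^sup>L (mb X) u) + ennreal (2 * \<eta> * gap X)"
    by (rule add_right_mono)
  also have "\<dots> = ennreal (integral\<^sup>L (mb X) u + 2 * \<eta> * gap X)"
    using nonneg gap_nonneg[of X] step by (simp add: ennreal_plus)
  also have "\<dots> \<le> ennreal ((norm (X - Xopt))\<^sup>2 + \<eta>\<^sup>2 * G\<^sup>2)"
    using gap int(2) by (intro ennreal_leI) simp
  finally show ?thesis .
qed

section \<open>The trajectory as a Markov chain\<close>

definition step_kernel :: "nat \<Rightarrow> (nat \<Rightarrow> real^'n^'n) \<Rightarrow> (nat \<Rightarrow> real^'n^'n) measure" where
  "step_kernel k x = distr (mb (x (Suc k))) paths (\<lambda>Z. x(Suc (Suc k) := update (x (Suc k)) Z))"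

text \<open>Naming the body of the bind gives the kernel lemmas something to apply to. Iterates
  count from 1 and steps from 0, hence the shift: step \<open>k\<close> reads index
  \<open>Suc k\<close>.\<close>

lemma trajectory_Suc: "trajectory (Suc k) = trajectory k \<bind> step_kernel k"
  by (simp add: step_kernel_def[abs_def])

lemma measurable_step_kernel [measurable]: "step_kernel k \<in> paths \<rightarrow>\<^sub>M prob_algebra paths"
  unfolding step_kernel_def[abs_def]
proof (rule measurable_distr_prob_space2)
  show "(\<lambda>x. mb (x (Suc k))) \<in> paths \<rightarrow>\<^sub>M prob_algebra borel" by measurable
  show "(\<lambda>(x, Z). x(Suc (Suc k) := update (x (Suc k)) Z)) \<in> paths \<Otimes>\<^sub>M borel \<rightarrow>\<^sub>M paths"
    unfolding case_prod_beta
    by (rule measurable_fun_upd[where J = UNIV]) measurable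
qed

lemma trajectory_space: "trajectory k \<in> space (prob_algebra paths)"
proof (induction k)
  case 0
  then show ?case by (auto simp: space_prob_algebra space_PiM intro!: prob_space_return)
next
  case (Suc k)
  then show ?case
    unfolding trajectory_Suc space_prob_algebra
    using prob_space_bind'[OF Suc measurable_step_kernel] sets_bind'[OF Suc measurable_step_kernel]
    by simp
qed

lemma sets_trajectory [measurable_cong]: "sets (trajectory k) = sets paths"
  and prob_space_trajectory: "prob_space (trajectory k)"
  using trajectory_space[of k] by (simp_all add: space_prob_algebra)

lemma step_kernel_subprob: "step_kernel k \<in> trajectory k \<rightarrow>\<^sub>M subprob_algebra paths"
  using measurable_prob_algebraD[OF measurable_step_kernel]
  by (simp add: measurable_cong_sets[OF sets_trajectory refl])

lemma measurable_next_iterate: "(\<lambda>Z. x(Suc (Suc k) := update (x (Suc k)) Z)) \<in> mb (x (Suc k)) \<rightarrow>\<^sub>M paths"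
proof -
  have "sets (mb (x (Suc k))) = sets borel"
    using measurable_space[OF measurable_mb, of "x (Suc k)"] by (simp add: space_prob_algebra)
  moreover have "(\<lambda>Z. x(Suc (Suc k) := update (x (Suc k)) Z)) \<in> borel \<rightarrow>\<^sub>M paths"
    by (rule measurable_fun_upd[where J = UNIV]) (measurable, auto simp: space_PiM)
  ultimately show ?thesis using measurable_cong_sets by blast
qed

text \<open>Provides the hypothesis of \<open>step_bound\<close> along the path. A step writes a
  projected point at one new index and keeps the other coordinates.\<close>

lemma AE_trajectory_mem: "AE x in trajectory k. \<forall>t\<in>{1..Suc k}. x t \<in> spectrahedron"
proof (induction k)
  case 0
  then show ?case by (subst sgd_path.simps, subst AE_return) (auto simp: start space_PiM)
next
  case (Suc k)
  have meas: "Measurable.pred paths (\<lambda>x. \<forall>t\<in>{1..Suc (Suc k)}. x t \<in> spectrahedron)"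
    by measurable
  show ?case
    unfolding trajectory_Suc AE_bind[OF step_kernel_subprob meas]
    using Suc
  proof eventually_elim
    fix x :: "nat \<Rightarrow> real^'n^'n" assume x: "\<forall>t\<in>{1..Suc k}. x t \<in> spectrahedron"
    show "AE y in step_kernel k x. \<forall>t\<in>{1..Suc (Suc k)}. y t \<in> spectrahedron"
      unfolding step_kernel_def
      using meas x update_mem
      by (subst AE_distr_iff[OF measurable_next_iterate]) (auto simp: pred_def)
  qed
qed

text \<open>
  The already paid regret is part of the potential, so that its mean grows by at most
  \<open>\<eta>\<^sup>2 G\<^sup>2\<close> per step.
\<close>

definition potential :: "nat \<Rightarrow> (nat \<Rightarrow> real^'n^'n) \<Rightarrow> ennreal" where
  "potential k x = ennreal ((norm (x (Suc k) - Xopt))\<^sup>2) + (\<Sum>t=1..k. ennreal (2 * \<eta> * gap (x t)))"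

lemma measurable_potential [measurable]: "potential k \<in> borel_measurable paths"
  unfolding potential_def[abs_def] by measurable

text \<open>This is \<open>step_bound\<close> with the paid regret carried along: the gap at
  \<open>x (Suc k)\<close> moves from the one-step inequality into the sum.\<close>

lemma potential_step:
  assumes "x (Suc k) \<in> spectrahedron"
  shows "(\<integral>\<^sup>+y. potential (Suc k) y \<partial>step_kernel k x) \<le> potential k x + ennreal (\<eta>\<^sup>2 * G\<^sup>2)"
proof -
  let ?X = "x (Suc k)"
  let ?s = "\<lambda>k. \<Sum>t=1..k. ennreal (2 * \<eta> * gap (x t))"
  note mb = minibatch_law[OF stoch _ batch, of ?X]
  have sym: "?X \<in> sym_matrices" using assms spectrahedron_subset_sym by blast
  interpret prob_space "mb ?X" by (rule mb(1)[OF sym])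
  have [measurable_cong]: "sets (mb ?X) = sets borel" by (rule mb(2)[OF sym])
  have [measurable]: "(\<lambda>Z. ennreal ((norm (update ?X Z - Xopt))\<^sup>2)) \<in> borel_measurable (mb ?X)"
    by measurable
  have "(\<integral>\<^sup>+y. potential (Suc k) y \<partial>step_kernel k x)
      = (\<integral>\<^sup>+Z. potential (Suc k) (x(Suc (Suc k) := update ?X Z)) \<partial>mb ?X)"
    unfolding step_kernel_def by (rule nn_integral_distr[OF measurable_next_iterate]) simp
  \<comment> \<open>The update touches index \<open>Suc (Suc k)\<close> only, so the sum up to
    \<open>Suc k\<close> is constant in \<open>Z\<close>.\<close>
  also have "\<dots> = (\<integral>\<^sup>+Z. ennreal ((norm (update ?X Z - Xopt))\<^sup>2) + ?s (Suc k) \<partial>mb ?X)"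
    by (intro nn_integral_cong) (simp add: potential_def)
  also have "\<dots> = (\<integral>\<^sup>+Z. ennreal ((norm (update ?X Z - Xopt))\<^sup>2) \<partial>mb ?X) + ?s (Suc k)"
    by (subst nn_integral_add) (auto simp: emeasure_space_1)
  also have "\<dots> = ((\<integral>\<^sup>+Z. ennreal ((norm (update ?X Z - Xopt))\<^sup>2) \<partial>mb ?X) + ennreal (2 * \<eta> * gap ?X)) + ?s k"
    by (simp add: ac_simps)
  also have "\<dots> \<le> ennreal ((norm (?X - Xopt))\<^sup>2 + \<eta>\<^sup>2 * G\<^sup>2) + ?s k"
    by (intro add_right_mono step_bound assms)
  also have "\<dots> = potential k x + ennreal (\<eta>\<^sup>2 * G\<^sup>2)"
    by (simp add: potential_def ennreal_plus ac_simps)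
  finally show ?thesis .
qed

lemma potential_bound:
  "(\<integral>\<^sup>+x. potential k x \<partial>trajectory k) \<le> ennreal ((norm (X\<^sub>1 - Xopt))\<^sup>2 + real k * (\<eta>\<^sup>2 * G\<^sup>2))"
proof (induction k)
  case 0
  show ?case
    by (subst sgd_path.simps, subst nn_integral_return) (auto simp: potential_def space_PiM)
next
  case (Suc k)
  interpret prob_space "trajectory k" by (rule prob_space_trajectory)
  have "(\<integral>\<^sup>+x. potential (Suc k) x \<partial>trajectory (Suc k))
      = (\<integral>\<^sup>+x. \<integral>\<^sup>+y. potential (Suc k) y \<partial>step_kernel k x \<partial>trajectory k)"
    unfolding trajectory_Suc by (rule nn_integral_bind[OF measurable_potential step_kernel_subprob])
  also have "\<dots> \<le> (\<integral>\<^sup>+x. potential k x + ennreal (\<eta>\<^sup>2 * G\<^sup>2) \<partial>trajectory k)"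
    using AE_trajectory_mem[of k] by (intro nn_integral_mono_AE) (auto elim!: eventually_mono intro: potential_step)
  also have "\<dots> = (\<integral>\<^sup>+x. potential k x \<partial>trajectory k) + ennreal (\<eta>\<^sup>2 * G\<^sup>2)"
    by (subst nn_integral_add) (auto simp: emeasure_space_1)
  also have "\<dots> \<le> ennreal ((norm (X\<^sub>1 - Xopt))\<^sup>2 + real k * (\<eta>\<^sup>2 * G\<^sup>2)) + ennreal (\<eta>\<^sup>2 * G\<^sup>2)"
    by (intro add_right_mono Suc)
  also have "\<dots> = ennreal ((norm (X\<^sub>1 - Xopt))\<^sup>2 + real (Suc k) * (\<eta>\<^sup>2 * G\<^sup>2))"
    by (subst ennreal_plus[symmetric]) (auto simp: algebra_simps)
  finally show ?case .
qed

text \<open>The distance term of \<open>potential k\<close> is spent on the last gap. Beyond the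
  initial squared distance, \<open>Suc k\<close> gaps thus cost \<open>Suc k\<close> times
  \<open>\<eta>\<^sup>2 * G\<^sup>2\<close>.\<close>

lemma sum_gap_bound:
  "(\<integral>\<^sup>+x. (\<Sum>t=1..Suc k. ennreal (gap (x t))) \<partial>trajectory k)
    \<le> ennreal (((norm (X\<^sub>1 - Xopt))\<^sup>2 + real (Suc k) * (\<eta>\<^sup>2 * G\<^sup>2)) / (2 * \<eta>))"
proof -
  interpret prob_space "trajectory k" by (rule prob_space_trajectory)
  let ?C = "(norm (X\<^sub>1 - Xopt))\<^sup>2 + real (Suc k) * (\<eta>\<^sup>2 * G\<^sup>2)"
  have scale: "ennreal (gap X) = ennreal (1 / (2 * \<eta>)) * ennreal (2 * \<eta> * gap X)" for X
    using step by (subst ennreal_mult''[symmetric]) (auto simp: gap_nonneg)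
  \<comment> \<open>the last iterate is never updated, but a virtual further step bounds its gap\<close>
  have "(\<integral>\<^sup>+x. (\<Sum>t=1..Suc k. ennreal (2 * \<eta> * gap (x t))) \<partial>trajectory k)
      \<le> (\<integral>\<^sup>+x. potential k x + ennreal (\<eta>\<^sup>2 * G\<^sup>2) \<partial>trajectory k)"
  proof (intro nn_integral_mono_AE)
    show "AE x in trajectory k. (\<Sum>t=1..Suc k. ennreal (2 * \<eta> * gap (x t))) \<le> potential k x + ennreal (\<eta>\<^sup>2 * G\<^sup>2)"
      using AE_trajectory_mem[of k]
    proof eventually_elim
      fix x :: "nat \<Rightarrow> real^'n^'n" assume x: "\<forall>t\<in>{1..Suc k}. x t \<in> spectrahedron"
      have "ennreal (2 * \<eta> * gap (x (Suc k))) \<le> ennreal ((norm (x (Suc k) - Xopt))\<^sup>2 + \<eta>\<^sup>2 * G\<^sup>2)"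
        using x by (intro order_trans[OF _ step_bound] add_increasing) auto
      also have "\<dots> = ennreal ((norm (x (Suc k) - Xopt))\<^sup>2) + ennreal (\<eta>\<^sup>2 * G\<^sup>2)"
        by (simp add: ennreal_plus)
      finally show "(\<Sum>t=1..Suc k. ennreal (2 * \<eta> * gap (x t))) \<le> potential k x + ennreal (\<eta>\<^sup>2 * G\<^sup>2)"
        by (simp add: potential_def ac_simps add_left_mono)
    qed
  qed
  also have "\<dots> = (\<integral>\<^sup>+x. potential k x \<partial>trajectory k) + ennreal (\<eta>\<^sup>2 * G\<^sup>2)"
    by (subst nn_integral_add) (auto simp: emeasure_space_1)
  also have "\<dots> \<le> ennreal ((norm (X\<^sub>1 - Xopt))\<^sup>2 + real k * (\<eta>\<^sup>2 * G\<^sup>2)) + ennreal (\<eta>\<^sup>2 * G\<^sup>2)"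
    by (intro add_right_mono potential_bound)
  also have "\<dots> = ennreal ?C"
    by (subst ennreal_plus[symmetric]) (auto simp: algebra_simps)
  finally have *: "(\<integral>\<^sup>+x. (\<Sum>t=1..Suc k. ennreal (2 * \<eta> * gap (x t))) \<partial>trajectory k) \<le> ennreal ?C" .
  have "(\<integral>\<^sup>+x. (\<Sum>t=1..Suc k. ennreal (gap (x t))) \<partial>trajectory k)
      = (\<integral>\<^sup>+x. ennreal (1 / (2 * \<eta>)) * (\<Sum>t=1..Suc k. ennreal (2 * \<eta> * gap (x t))) \<partial>trajectory k)"
    by (simp only: scale sum_distrib_left)
  also have "\<dots> = ennreal (1 / (2 * \<eta>)) * (\<integral>\<^sup>+x. (\<Sum>t=1..Suc k. ennreal (2 * \<eta> * gap (x t))) \<partial>trajectory k)"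
    by (rule nn_integral_cmult) measurable
  also have "\<dots> \<le> ennreal (1 / (2 * \<eta>)) * ennreal ?C"
    by (intro mult_left_mono *) simp
  also have "\<dots> = ennreal (?C / (2 * \<eta>))"
    using step by (subst ennreal_mult'[symmetric]) auto
  finally show ?thesis .
qed

section \<open>From the mean gap to the success probability of both outputs\<close>

lemma Markov_gap:
  assumes "prob_space M" and sets: "sets M = sets borel" and mem: "AE X in M. X \<in> spectrahedron"
    and mean: "(\<integral>\<^sup>+X. ennreal (gap X) \<partial>M) \<le> ennreal (\<epsilon> / 2)" and \<epsilon>: "0 < \<epsilon>"
  shows "1/2 \<le> measure M {X \<in> spectrahedron. f X - f Xopt \<le> \<epsilon>}"
proof -
  interpret prob_space M by fact
  note [measurable_cong] = sets
  have sp: "space M = UNIV" using sets_eq_imp_space_eq[OF sets] by simp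
  \<comment> \<open>\<open>?A\<close> is the event that the gap is at least
    \<open>\<epsilon>\<close>, in the scaled form of Markov's inequality. Off \<open>?A\<close> the
    gap is below \<open>\<epsilon>\<close>.\<close>
  let ?A = "{X. 1 \<le> ennreal (1 / \<epsilon>) * ennreal (gap X)}"
  have A: "?A \<in> sets M" unfolding sets by measurable
  have gm: "(\<lambda>X. ennreal (gap X)) \<in> borel_measurable M" by measurable
  have "emeasure M ?A \<le> ennreal (1 / \<epsilon>) * (\<integral>\<^sup>+X. ennreal (gap X) \<partial>M)"
    using nn_integral_Markov_inequality[of "\<lambda>X. ennreal (gap X)" UNIV M "ennreal (1 / \<epsilon>)"] sp gm
    by simp
  also have "\<dots> \<le> ennreal (1 / \<epsilon>) * ennreal (\<epsilon> / 2)"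
    by (intro mult_left_mono mean) simp
  also have "\<dots> = ennreal (1/2)"
    using \<epsilon> by (subst ennreal_mult'[symmetric]) auto
  finally have "prob ?A \<le> 1/2"
    unfolding emeasure_eq_measure by (subst (asm) ennreal_le_iff) auto
  moreover have "prob ?A + prob (- ?A) = 1"
    using prob_compl[OF A] sp by (simp add: Compl_eq_Diff_UNIV)
  moreover have "prob (- ?A) \<le> measure M {X \<in> spectrahedron. f X - f Xopt \<le> \<epsilon>}"
  proof (rule finite_measure_mono_AE)
    show "AE X in M. X \<in> - ?A \<longrightarrow> X \<in> {X \<in> spectrahedron. f X - f Xopt \<le> \<epsilon>}"
      using mem
    proof eventually_elim
      fix X :: "real^'n^'n" assume X: "X \<in> spectrahedron"
      have "ennreal (1 / \<epsilon>) * ennreal (gap X) = ennreal (gap X / \<epsilon>)"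
        using \<epsilon> by (subst ennreal_mult'[symmetric]) auto
      then show "X \<in> - ?A \<longrightarrow> X \<in> {X \<in> spectrahedron. f X - f Xopt \<le> \<epsilon>}"
        using X \<epsilon> by (auto simp: gap_def not_le field_simps)
    qed
    \<comment> \<open>Measurability of \<open>f\<close> on the whole space is not given, so the
      success event is rewritten through \<open>gap\<close>.\<close>
    have "{X \<in> spectrahedron. f X - f Xopt \<le> \<epsilon>} = {X. X \<in> spectrahedron \<and> gap X \<le> \<epsilon>}"
      by (auto simp: gap_def)
    also have "\<dots> \<in> sets M" unfolding sets by measurable
    finally show "{X \<in> spectrahedron. f X - f Xopt \<le> \<epsilon>} \<in> sets M" .
  qed
  ultimately show ?thesis by linarith
qed

text \<open>For a fixed path the uniform index turns the mean gap into the average of all gaps along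
  it; Tonelli then leads to \<open>sum_gap_bound\<close>.\<close>

lemma random_iterate_success:
  assumes T: "1 \<le> T" and \<epsilon>: "0 < \<epsilon>"
    and small: "((norm (X\<^sub>1 - Xopt))\<^sup>2 + real T * (\<eta>\<^sup>2 * G\<^sup>2)) / (2 * \<eta> * real T) \<le> \<epsilon> / 2"
  shows "1/2 \<le> measure (sgd_random_iterate orc T L \<eta> X\<^sub>1) {X \<in> spectrahedron. f X - f Xopt \<le> \<epsilon>}"
proof -
  \<comment> \<open>\<open>T - 1\<close> steps produce \<open>T\<close> iterates.\<close>
  define k where "k = T - 1"
  have k: "T = Suc k" using T by (simp add: k_def)
  let ?U = "measure_pmf (pmf_of_set {1..T})"
  let ?Q = "trajectory k \<Otimes>\<^sub>M ?U"
  interpret pair_sigma_finite "trajectory k" ?U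
    by (intro pair_sigma_finite.intro prob_space_imp_sigma_finite prob_space_trajectory prob_space_measure_pmf)
  \<comment> \<open>Evaluation at a random index is measurable because the index takes countably
    many values.\<close>
  have ev [measurable]: "(\<lambda>(x, t). x t) \<in> ?Q \<rightarrow>\<^sub>M (borel :: (real^'n^'n) measure)"
    unfolding case_prod_beta
    by (rule measurable_compose_countable[where f = "\<lambda>t z. fst z t" and g = snd]) measurable
  have law: "sgd_random_iterate orc T L \<eta> X\<^sub>1 = distr ?Q borel (\<lambda>(x, t). x t)"
    by (simp add: sgd_random_iterate_def k_def)
  show ?thesis
    unfolding law
  proof (rule Markov_gap[OF _ _ _ _ \<epsilon>])
    show "prob_space (distr ?Q borel (\<lambda>(x, t). x t))" 
      by (intro prob_space.prob_space_distr prob_space_pair prob_space_trajectory prob_space_measure_pmf ev)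
    have "AE z in ?Q. (case z of (x, t) \<Rightarrow> x t) \<in> spectrahedron"
    proof (rule AE_pair_measure)
      show "{z \<in> space ?Q. (case z of (x, t) \<Rightarrow> x t) \<in> spectrahedron} \<in> sets ?Q" by measurable
      show "AE x in trajectory k. AE t in ?U. (case (x, t) of (x, t) \<Rightarrow> x t) \<in> spectrahedron"
        using AE_trajectory_mem[of k] T by (auto elim!: eventually_mono simp: AE_measure_pmf_iff k)
    qed
    then show "AE X in distr ?Q borel (\<lambda>(x, t). x t). X \<in> spectrahedron"
      by (subst AE_distr_iff) auto
    have "(\<integral>\<^sup>+X. ennreal (gap X) \<partial>distr ?Q borel (\<lambda>(x, t). x t))
        = (\<integral>\<^sup>+z. ennreal (gap (case z of (x, t) \<Rightarrow> x t)) \<partial>?Q)"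
      by (rule nn_integral_distr[OF ev]) (simp add: measurable_ennreal_gap)
    also have "\<dots> = (\<integral>\<^sup>+x. \<integral>\<^sup>+t. ennreal (gap (x t)) \<partial>?U \<partial>trajectory k)"
      using sigma_finite_measure.nn_integral_fst[OF prob_space_imp_sigma_finite[OF prob_space_measure_pmf]
          measurable_compose[OF ev measurable_ennreal_gap]] by simp
    also have "\<dots> = (\<integral>\<^sup>+x. (\<Sum>t=1..T. ennreal (gap (x t))) / ennreal (real T) \<partial>trajectory k)"
      using T by (subst nn_integral_pmf_of_set) (auto simp: ennreal_of_nat_eq_real_of_nat)
    also have "\<dots> = (\<integral>\<^sup>+x. (\<Sum>t=1..T. ennreal (gap (x t))) \<partial>trajectory k) / ennreal (real T)"
      by (rule nn_integral_divide) measurable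
    also have "\<dots> \<le> ennreal (((norm (X\<^sub>1 - Xopt))\<^sup>2 + real T * (\<eta>\<^sup>2 * G\<^sup>2)) / (2 * \<eta>)) / ennreal (real T)"
      using sum_gap_bound[of k] by (intro divide_right_mono_ennreal) (simp add: k)
    also have "\<dots> = ennreal (((norm (X\<^sub>1 - Xopt))\<^sup>2 + real T * (\<eta>\<^sup>2 * G\<^sup>2)) / (2 * \<eta> * real T))"
      using step T by (subst divide_ennreal) (auto intro!: divide_nonneg_nonneg add_nonneg_nonneg)
    also have "\<dots> \<le> ennreal (\<epsilon> / 2)" using small by (rule ennreal_leI)
    finally show "(\<integral>\<^sup>+X. ennreal (gap X) \<partial>distr ?Q borel (\<lambda>(x, t). x t)) \<le> ennreal (\<epsilon> / 2)" .
  qed simp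
qed

text \<open>Jensen's inequality bounds the gap of the average by the average of the gaps, so this
  output obeys the same bound as the random iterate.\<close>

lemma average_success:
  assumes T: "1 \<le> T" and \<epsilon>: "0 < \<epsilon>"
    and small: "((norm (X\<^sub>1 - Xopt))\<^sup>2 + real T * (\<eta>\<^sup>2 * G\<^sup>2)) / (2 * \<eta> * real T) \<le> \<epsilon> / 2"
  shows "1/2 \<le> measure (sgd_average orc T L \<eta> X\<^sub>1) {X \<in> spectrahedron. f X - f Xopt \<le> \<epsilon>}"
proof -
  define k where "k = T - 1"
  have k: "T = Suc k" using T by (simp add: k_def)
  interpret P: prob_space "trajectory k" by (rule prob_space_trajectory)
  let ?a = "\<lambda>x :: nat \<Rightarrow> real^'n^'n. (1 / real T) *\<^sub>R (\<Sum>i=1..T. x i)"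
  have ev [measurable]: "?a \<in> trajectory k \<rightarrow>\<^sub>M borel" by measurable
  have law: "sgd_average orc T L \<eta> X\<^sub>1 = distr (trajectory k) borel ?a"
    by (simp add: sgd_average_def k_def)
  have avg: "?a x \<in> spectrahedron \<and> gap (?a x) \<le> (\<Sum>t=1..T. gap (x t)) / real T"
    if x: "\<forall>t\<in>{1..Suc k}. x t \<in> spectrahedron" for x
  proof -
    have a: "?a x = (\<Sum>t=1..T. (1 / real T) *\<^sub>R x t)" by (simp add: scaleR_sum_right)
    have mem: "?a x \<in> spectrahedron"
      unfolding a using x T by (intro convex_sum convex_spectrahedron) (auto simp: k)
    have "f (?a x) \<le> (\<Sum>t=1..T. (1 / real T) * f (x t))"
      unfolding a using x T spectrahedron_subset_sym
      by (intro convex_on_sum[OF _ _ cvx]) (auto simp: k)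
    \<comment> \<open>Along such a path the indicator in \<open>gap\<close> is 1.\<close>
    moreover have "(\<Sum>t=1..T. gap (x t)) = (\<Sum>t=1..T. f (x t) - f Xopt)"
      using x by (intro sum.cong) (auto simp: gap_def k)
    ultimately show ?thesis
      using mem T by (simp add: gap_def sum_subtractf diff_divide_distrib sum_divide_distrib)
  qed
  show ?thesis
    unfolding law
  proof (rule Markov_gap[OF _ _ _ _ \<epsilon>])
    show "prob_space (distr (trajectory k) borel ?a)" by (rule P.prob_space_distr) (rule ev)
    show "AE X in distr (trajectory k) borel ?a. X \<in> spectrahedron"
      using AE_trajectory_mem[of k] avg by (subst AE_distr_iff) (auto elim!: eventually_mono)
    have "(\<integral>\<^sup>+X. ennreal (gap X) \<partial>distr (trajectory k) borel ?a) = (\<integral>\<^sup>+x. ennreal (gap (?a x)) \<partial>trajectory k)"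
      by (rule nn_integral_distr[OF ev]) (simp add: measurable_ennreal_gap)
    also have "\<dots> \<le> (\<integral>\<^sup>+x. (\<Sum>t=1..T. ennreal (gap (x t))) / ennreal (real T) \<partial>trajectory k)"
    proof (rule nn_integral_mono_AE)
      show "AE x in trajectory k. ennreal (gap (?a x)) \<le> (\<Sum>t=1..T. ennreal (gap (x t))) / ennreal (real T)"
        using AE_trajectory_mem[of k]
      proof eventually_elim
        fix x :: "nat \<Rightarrow> real^'n^'n" assume x: "\<forall>t\<in>{1..Suc k}. x t \<in> spectrahedron"
        have "(\<Sum>t=1..T. ennreal (gap (x t))) / ennreal (real T) = ennreal ((\<Sum>t=1..T. gap (x t)) / real T)"
          using T by (subst sum_ennreal) (auto simp: gap_nonneg divide_ennreal sum_nonneg)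
        then show "ennreal (gap (?a x)) \<le> (\<Sum>t=1..T. ennreal (gap (x t))) / ennreal (real T)"
          using avg[OF x] by (simp add: ennreal_leI)
      qed
    qed
    also have "\<dots> = (\<integral>\<^sup>+x. (\<Sum>t=1..T. ennreal (gap (x t))) \<partial>trajectory k) / ennreal (real T)"
      by (rule nn_integral_divide) measurable
    also have "\<dots> \<le> ennreal (((norm (X\<^sub>1 - Xopt))\<^sup>2 + real T * (\<eta>\<^sup>2 * G\<^sup>2)) / (2 * \<eta>)) / ennreal (real T)"
      using sum_gap_bound[of k] by (intro divide_right_mono_ennreal) (simp add: k)
    also have "\<dots> = ennreal (((norm (X\<^sub>1 - Xopt))\<^sup>2 + real T * (\<eta>\<^sup>2 * G\<^sup>2)) / (2 * \<eta> * real T))"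
      using step T by (subst divide_ennreal) (auto intro!: divide_nonneg_nonneg add_nonneg_nonneg)
    also have "\<dots> \<le> ennreal (\<epsilon> / 2)" using small by (rule ennreal_leI)
    finally show "(\<integral>\<^sup>+X. ennreal (gap X) \<partial>distr (trajectory k) borel ?a) \<le> ennreal (\<epsilon> / 2)" .
  qed simp
qed

end

section \<open>Horizon and step-size\<close>

text \<open>In its use, \<open>a\<close> is \<open>R\<^sub>0 * G\<close> and \<open>c\<close> is the
  factor of the logarithm in the batch scale. The first conjunct keeps that scale at least 1; the
  last asks that twice the error bound of \<open>step_size_error\<close> be at most
  \<open>\<epsilon>\<close>.\<close>

lemma horizon_exists:
  fixes a c n :: real
  assumes pos: "a > 0" "c > 0" "n > 0"
  shows "\<exists>\<epsilon>\<^sub>0>0. \<forall>\<epsilon>. 0 < \<epsilon> \<and> \<epsilon> < \<epsilon>\<^sub>0 \<longrightarrow> (\<exists>T\<ge>1. 1 \<le> c * ln (n * real T) \<and>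
    ln (n * real T) \<le> 3 * ln (n / \<epsilon>) \<and> 1 \<le> ln (n / \<epsilon>) \<and>
    real T \<le> 65 * a\<^sup>2 * (ln (n / \<epsilon>))\<^sup>2 / \<epsilon>\<^sup>2 \<and>
    13/5 * a * ln (8 * real T) / sqrt (real T) \<le> \<epsilon>)"
    (is "\<exists>\<epsilon>\<^sub>0>0. \<forall>\<epsilon>. 0 < \<epsilon> \<and> \<epsilon> < \<epsilon>\<^sub>0 \<longrightarrow> ?P \<epsilon>")
proof -
  \<comment> \<open>In order: the logarithm is at least 1; \<open>q\<close> is at least 1;
    \<open>8 * T\<close> and \<open>n * T\<close> stay below the cube of
    \<open>n / \<epsilon>\<close>, as squares with logarithms are eventually below cubes; the batch
    scale is at least 1.\<close>
  have ev: "\<forall>\<^sub>F \<epsilon> in at_right 0. 1 \<le> ln (n / \<epsilon>)"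
    "\<forall>\<^sub>F \<epsilon> in at_right 0. 1 \<le> a\<^sup>2 * (ln (n / \<epsilon>))\<^sup>2 / \<epsilon>\<^sup>2"
    "\<forall>\<^sub>F \<epsilon> in at_right 0. 8 * (65 * a\<^sup>2 * (ln (n / \<epsilon>))\<^sup>2 / \<epsilon>\<^sup>2) \<le> (n / \<epsilon>) ^ 3"
    "\<forall>\<^sub>F \<epsilon> in at_right 0. n * (65 * a\<^sup>2 * (ln (n / \<epsilon>))\<^sup>2 / \<epsilon>\<^sup>2) \<le> (n / \<epsilon>) ^ 3"
    "\<forall>\<^sub>F \<epsilon> in at_right 0. 1 \<le> c * ln (n * (a\<^sup>2 * (ln (n / \<epsilon>))\<^sup>2 / \<epsilon>\<^sup>2))"
    using pos by real_asymp+
  have "\<forall>\<^sub>F \<epsilon> in at_right 0. ?P \<epsilon>"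
    using ev eventually_at_right_less[of 0]
  proof eventually_elim
    case (elim \<epsilon>)
    define \<kappa> where "\<kappa> = ln (n / \<epsilon>)"
    define q where "q = a\<^sup>2 * \<kappa>\<^sup>2 / \<epsilon>\<^sup>2"
    \<comment> \<open>The factor 64 becomes 8 under the square root. Rounding up adds at most 1,
      hence at most \<open>q\<close>, which explains 65.\<close>
    define T where "T = nat \<lceil>64 * q\<rceil>"
    note elim = elim[folded \<kappa>_def]
    have q: "1 \<le> q" using elim(2) by (simp add: q_def)
    have q65: "65 * a\<^sup>2 * \<kappa>\<^sup>2 / \<epsilon>\<^sup>2 = 65 * q" by (simp add: q_def)
    have T: "64 * q \<le> real T" "real T \<le> 65 * q"
      using q by (auto simp: T_def of_nat_nat ceiling_le_iff intro: order_trans[OF of_int_ceiling_le_add_one])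
    have T1: "1 \<le> real T" using T q by linarith
    have ln3: "ln x \<le> 3 * \<kappa>" if "0 < x" "x \<le> (n / \<epsilon>) ^ 3" for x
    proof -
      have "ln x \<le> ln ((n / \<epsilon>) ^ 3)" using that by (simp add: ln_mono)
      also have "\<dots> = 3 * \<kappa>" using pos elim(6) by (simp add: \<kappa>_def ln_realpow)
      finally show ?thesis .
    qed
    have l8: "ln (8 * real T) \<le> 3 * \<kappa>"
      using T T1 elim(3) unfolding q65 by (intro ln3) auto
    have nT: "n * real T \<le> n * (65 * q)" using T pos by simp
    have ln: "ln (n * real T) \<le> 3 * \<kappa>"
      using T1 elim(4) pos unfolding q65 by (intro ln3 order_trans[OF nT]) auto
    have "n * q \<le> n * real T" using T q pos by simp
    then have "ln (n * q) \<le> ln (n * real T)" using q pos by (intro ln_mono) auto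
    then have "c * ln (n * q) \<le> c * ln (n * real T)" using pos by simp
    then have c: "1 \<le> c * ln (n * real T)" using elim(5) by (simp add: q_def)
    have "8 * a * \<kappa> / \<epsilon> = sqrt (64 * q)"
      using pos elim(1,6) by (simp add: q_def real_sqrt_mult real_sqrt_divide)
    also have "\<dots> \<le> sqrt (real T)" using T by simp
    finally have s: "8 * a * \<kappa> \<le> \<epsilon> * sqrt (real T)"
      using elim(6) by (simp add: field_simps)
    have "13/5 * a * ln (8 * real T) \<le> 13/5 * a * (3 * \<kappa>)"
      using l8 pos by simp
    \<comment> \<open>\<open>13/5 * 3 = 39/5\<close> is just below 8.\<close>
    also have "\<dots> \<le> 8 * a * \<kappa>" using pos elim(1) by simp
    also note s
    finally have "13/5 * a * ln (8 * real T) / sqrt (real T) \<le> \<epsilon>"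
      using T1 by (simp add: divide_le_eq)
    then show ?case
      using T1 T c ln elim(1) unfolding \<kappa>_def[symmetric] q65 by (intro exI[of _ T]) auto
  qed
  then obtain b where "b > 0" "\<forall>\<epsilon>>0. \<epsilon> < b \<longrightarrow> ?P \<epsilon>"
    unfolding eventually_at_right_field by auto
  then show ?thesis by blast
qed

text \<open>With the step-size inserted, the distance term contributes at most 5/4 and the noise
  term at most 1/20 times \<open>R * G * l / s\<close>, where \<open>s\<close> and \<open>l\<close>
  are the root and the logarithm; the sum is 13/10.\<close>

lemma step_size_error:
  assumes R: "0 < R" and G: "0 < G" and T: "1 \<le> T" and d: "0 \<le> d" "d \<le> R / 2"
  shows "(d\<^sup>2 + real T * ((step_size R G T)\<^sup>2 * G\<^sup>2)) / (2 * step_size R G T * real T)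
    \<le> 13/10 * (R * G) * ln (8 * real T) / sqrt (real T)"
proof -
  define s where "s = sqrt (real T)"
  define l where "l = ln (8 * real T)"
  define \<eta> where "\<eta> = step_size R G T"
  have s: "0 < s" "real T = s\<^sup>2" using T by (auto simp: s_def)
  \<comment> \<open>The 8 inside the logarithm guarantees \<open>1 \<le> l\<close>, which later lets
    \<open>1 / l\<close> be replaced by \<open>l\<close>.\<close>
  have "exp 1 \<le> 8 * real T" using exp_le T by linarith
  then have l: "1 \<le> l" using T by (simp add: l_def ln_ge_iff)
  have eta: "\<eta> = R / (10 * G * s * l)" by (simp add: \<eta>_def step_size_def s_def l_def)
  have eta0: "0 < \<eta>" using R G s l by (simp add: eta)
  have "d\<^sup>2 \<le> (R / 2)\<^sup>2" using d by (intro power_mono)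
  then have "(d\<^sup>2 + s\<^sup>2 * (\<eta>\<^sup>2 * G\<^sup>2)) / (2 * \<eta> * s\<^sup>2) \<le> ((R / 2)\<^sup>2 + s\<^sup>2 * (\<eta>\<^sup>2 * G\<^sup>2)) / (2 * \<eta> * s\<^sup>2)"
    using eta0 s by (intro divide_right_mono) auto
  also have "\<dots> = R\<^sup>2 / (8 * \<eta> * s\<^sup>2) + \<eta> * G\<^sup>2 / 2"
    using eta0 s by (simp add: field_simps power2_eq_square)
  also have "R\<^sup>2 / (8 * \<eta> * s\<^sup>2) = 5/4 * (R * G) * l / s"
    using R G s l by (simp add: eta field_simps power2_eq_square)
  also have "\<eta> * G\<^sup>2 / 2 = 1/20 * (R * G) / (s * l)"
    using R G s l by (simp add: eta field_simps power2_eq_square)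
  also have "1/20 * (R * G) / (s * l) \<le> 1/20 * (R * G) * l / s"
  proof -
    have "1 / l \<le> l" using l by (simp add: divide_le_eq) (metis mult_mono' mult_1 zero_le_one)
    then have "1/20 * (R * G) / s * (1 / l) \<le> 1/20 * (R * G) / s * l"
      using R G s by (intro mult_left_mono) auto
    then show ?thesis by simp
  qed
  finally show ?thesis
    by (simp add: s(2)[symmetric] \<eta>_def l_def s_def algebra_simps)
qed

section \<open>Choice of the parameters and the total sample count\<close>

theorem corollary1:
  fixes f :: "real^'n^'n \<Rightarrow> real"
    and f' :: "real^'n^'n \<Rightarrow> real^'n^'n"
    and orc :: "real^'n^'n \<Rightarrow> (real^'n^'n) measure"
    and Xopt :: "real^'n^'n"
    and r n :: nat
    and \<beta> G B \<sigma> \<delta> R\<^sub>0 :: real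
  defines "n \<equiv> CARD('n)"
    and "R\<^sub>0 \<equiv> warm_radius r \<beta> B \<delta> Xopt"
  assumes "convex_on sym_matrices f"
    and "is_gradient f f'"
    and "\<beta>-lipschitz_on sym_matrices f'"
    and "G > 0" and "B > 0" and "\<sigma> > 0"
    and "stochastic_oracle orc f' G B \<sigma>"
    and "is_arg_min f (\<lambda>X. X \<in> spectrahedron) Xopt"
    and "rank Xopt = r" and "r < n"
    and "eigval (n - r) (f' Xopt) - eigval n (f' Xopt) > 0"
    and "0 < \<delta>" and "\<delta> \<le> eigval (n - r) (f' Xopt) - eigval n (f' Xopt)"
  shows "\<exists>\<epsilon>\<^sub>0>0. \<forall>\<epsilon>. 0 < \<epsilon> \<and> \<epsilon> < \<epsilon>\<^sub>0 \<longrightarrow>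
    (\<exists>T\<ge>1. \<exists>L\<ge>1.
       batch_scale n r G B \<sigma> \<delta> R\<^sub>0 T \<le> real L \<and>
       real L \<le> 2 * batch_scale n r G B \<sigma> \<delta> R\<^sub>0 T \<and>
       real (T * L) \<le> 1000 * (ln (real n / \<epsilon>)) ^ 3 * (1 / \<epsilon>\<^sup>2) *
          max (\<sigma>\<^sup>2) ((eigval r Xopt)\<^sup>2 * real r * G\<^sup>2) \<and>
       (\<forall>X\<^sub>1 \<in> spectrahedron. rank X\<^sub>1 \<le> r \<and> norm (X\<^sub>1 - Xopt) \<le> R\<^sub>0 / 2 \<longrightarrow>
          measure (sgd_random_iterate orc T L (step_size R\<^sub>0 G T) X\<^sub>1)
            {X \<in> spectrahedron. f X - f Xopt \<le> \<epsilon>} \<ge> 1/2 \<and>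
          measure (sgd_average orc T L (step_size R\<^sub>0 G T) X\<^sub>1)
            {X \<in> spectrahedron. f X - f Xopt \<le> \<epsilon>} \<ge> 1/2))"
proof -
  define ev where "ev = eigval r Xopt"
  have Xopt: "transpose Xopt = Xopt" "\<And>v. 0 \<le> v \<bullet> (Xopt *v v)" "trace Xopt = 1"
    using \<open>is_arg_min f (\<lambda>X. X \<in> spectrahedron) Xopt\<close>
    by (auto simp: is_arg_min_def spectrahedron_def sym_matrices_def)
  \<comment> \<open>Trace 1 excludes rank 0, so the \<open>r\<close>-th eigenvalue makes sense and
    is positive.\<close>
  have "Xopt \<noteq> 0" using Xopt(3) by (auto simp: trace_def)
  then have r: "1 \<le> r" using \<open>rank Xopt = r\<close> rank_eq_0[of Xopt] by linarith
  have ev: "0 < ev"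
    unfolding ev_def using eigval_rank_pos[OF Xopt(1,2)] r \<open>rank Xopt = r\<close> by simp
  have n: "0 < real n" using \<open>r < n\<close> by simp
  have \<beta>: "0 \<le> \<beta>" using \<open>\<beta>-lipschitz_on sym_matrices f'\<close> by (rule lipschitz_on_nonneg)
  note pos = \<open>G > 0\<close> \<open>B > 0\<close> \<open>0 < \<delta>\<close> ev \<beta>
  define D where "D = sqrt (2 * real r) * B / ev"
  have D: "0 < D" using pos r by (simp add: D_def)
  have R0: "R\<^sub>0 = \<delta> / (8 * (real r * \<beta> + D))"
    by (simp add: R\<^sub>0_def warm_radius_def D_def ev_def field_simps)
  have Rpos: "0 < R\<^sub>0" using pos D by (simp add: R0 add_nonneg_pos)
  \<comment> \<open>Dropping the smoothness term from the denominator leaves the part with the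
    eigenvalue; \<open>\<delta>\<close> and \<open>B\<close> then cancel.\<close>
  have "R\<^sub>0 \<le> \<delta> / (8 * D)"
    unfolding R0 using pos D by (intro divide_left_mono) (auto simp: add_nonneg_pos)
  then have "R\<^sub>0 * B * real r / \<delta> \<le> \<delta> / (8 * D) * B * real r / \<delta>"
    using pos by (intro divide_right_mono mult_right_mono) auto
  also have "\<dots> = ev * real r / (8 * sqrt (2 * real r))"
    using pos by (simp add: D_def field_simps)
  finally have "(R\<^sub>0 * B * real r / \<delta>)\<^sup>2 \<le> (ev * real r / (8 * sqrt (2 * real r)))\<^sup>2"
    using Rpos pos by (intro power_mono) auto
  \<comment> \<open>The square of \<open>8 * sqrt (2 * real r)\<close> is
    \<open>128 * real r\<close>.\<close>
  also have "\<dots> = ev\<^sup>2 * real r / 128"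
    using r by (simp add: power_divide power_mult_distrib power2_eq_square)
  also have "\<dots> \<le> ev\<^sup>2 * real r" by simp
  finally have R0_bound: "(R\<^sub>0 * B * real r / \<delta>)\<^sup>2 \<le> ev\<^sup>2 * real r" .
  define a where "a = R\<^sub>0 * G"
  define c where "c = B\<^sup>2 * (real r)\<^sup>2 / \<delta>\<^sup>2"
  have a: "0 < a" and c: "0 < c" using pos Rpos r by (auto simp: a_def c_def)
  define W where "W = max (\<sigma>\<^sup>2) (ev\<^sup>2 * real r * G\<^sup>2)"
  \<comment> \<open>The horizon carries \<open>a\<^sup>2\<close> and one branch of the batch scale
    carries \<open>c\<close>, so \<open>W\<close> has to absorb their product.\<close>
  have "a\<^sup>2 * c = (R\<^sub>0 * B * real r / \<delta>)\<^sup>2 * G\<^sup>2"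
    by (simp add: a_def c_def power_mult_distrib power_divide)
  also have "\<dots> \<le> ev\<^sup>2 * real r * G\<^sup>2" using R0_bound by (rule mult_right_mono) simp
  finally have W: "\<sigma>\<^sup>2 \<le> W" "a\<^sup>2 * c \<le> W" by (auto simp: W_def)
  obtain \<epsilon>\<^sub>0 where "\<epsilon>\<^sub>0 > 0" and *: "\<And>\<epsilon>. 0 < \<epsilon> \<Longrightarrow> \<epsilon> < \<epsilon>\<^sub>0 \<Longrightarrow> (\<exists>T\<ge>1. 1 \<le> c * ln (real n * real T) \<and>
    ln (real n * real T) \<le> 3 * ln (real n / \<epsilon>) \<and> 1 \<le> ln (real n / \<epsilon>) \<and>
    real T \<le> 65 * a\<^sup>2 * (ln (real n / \<epsilon>))\<^sup>2 / \<epsilon>\<^sup>2 \<and>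
    13/5 * a * ln (8 * real T) / sqrt (real T) \<le> \<epsilon>)"
    using horizon_exists[OF a c n] by blast
  show ?thesis
  proof (intro exI[of _ \<epsilon>\<^sub>0] conjI allI impI)
    fix \<epsilon> :: real assume \<epsilon>: "0 < \<epsilon> \<and> \<epsilon> < \<epsilon>\<^sub>0"
    define \<kappa> where "\<kappa> = ln (real n / \<epsilon>)"
    obtain T where T: "1 \<le> T" "1 \<le> c * ln (real n * real T)" "ln (real n * real T) \<le> 3 * \<kappa>"
      "1 \<le> \<kappa>" "real T \<le> 65 * a\<^sup>2 * \<kappa>\<^sup>2 / \<epsilon>\<^sup>2" "13/5 * a * ln (8 * real T) / sqrt (real T) \<le> \<epsilon>"
      using *[of \<epsilon>] \<epsilon> unfolding \<kappa>_def by blast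
    define S where "S = batch_scale n r G B \<sigma> \<delta> R\<^sub>0 T"
    have S: "S = max (\<sigma>\<^sup>2 / a\<^sup>2) (c * ln (real n * real T))"
      by (simp add: S_def batch_scale_def a_def c_def power_divide mult.commute)
    \<comment> \<open>With \<open>1 \<le> S\<close>, rounding up to \<open>L\<close> at most doubles
      it.\<close>
    have S1: "1 \<le> S" using T(2) by (simp add: S)
    define L where "L = nat \<lceil>S\<rceil>"
    have "real L = of_int \<lceil>S\<rceil>" using S1 by (simp add: L_def)
    then have L: "S \<le> real L" "real L \<le> 2 * S"
      using S1 by linarith+
    have L1: "1 \<le> L" using L S1 by linarith
    \<comment> \<open>The factor \<open>a\<^sup>2\<close> of the horizon cancels the denominator in
      the variance branch of \<open>S\<close> and turns the other branch into
      \<open>a\<^sup>2 * c\<close> times a logarithm.\<close>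
    have "a\<^sup>2 * S \<le> 3 * \<kappa> * W"
    proof -
      have "a\<^sup>2 * (\<sigma>\<^sup>2 / a\<^sup>2) = \<sigma>\<^sup>2" using a by simp
      also have "\<dots> \<le> W" by (rule W)
      also have "\<dots> \<le> 3 * \<kappa> * W" using T(4) W(1) order_trans[OF zero_le_power2 W(1)]
        by (simp add: mult_le_cancel_right1)
      finally have 1: "a\<^sup>2 * (\<sigma>\<^sup>2 / a\<^sup>2) \<le> 3 * \<kappa> * W" .
      have "a\<^sup>2 * (c * ln (real n * real T)) \<le> a\<^sup>2 * c * (3 * \<kappa>)"
        using T(3) c by (simp add: mult.assoc mult_left_mono)
      also have "\<dots> \<le> W * (3 * \<kappa>)" using W(2) T(4) by (intro mult_right_mono) auto
      finally have 2: "a\<^sup>2 * (c * ln (real n * real T)) \<le> 3 * \<kappa> * W" by (simp add: ac_simps)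
      show ?thesis using 1 2 by (simp add: S max_def)
    qed
    then have aS: "130 * \<kappa>\<^sup>2 / \<epsilon>\<^sup>2 * (a\<^sup>2 * S) \<le> 130 * \<kappa>\<^sup>2 / \<epsilon>\<^sup>2 * (3 * \<kappa> * W)"
      by (intro mult_left_mono) auto
    have W0: "0 \<le> W" using order_trans[OF zero_le_power2 W(1)] .
    have "real (T * L) \<le> (65 * a\<^sup>2 * \<kappa>\<^sup>2 / \<epsilon>\<^sup>2) * (2 * S)"
      unfolding of_nat_mult using T(5) L(2) by (intro mult_mono) auto
    also have "\<dots> = 130 * \<kappa>\<^sup>2 / \<epsilon>\<^sup>2 * (a\<^sup>2 * S)" by simp
    also note aS
    \<comment> \<open>390 is 65 from the horizon, 2 from rounding the batch-size and 3 from the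
      logarithm.\<close>
    also have "130 * \<kappa>\<^sup>2 / \<epsilon>\<^sup>2 * (3 * \<kappa> * W) = 390 * \<kappa> ^ 3 * (1 / \<epsilon>\<^sup>2) * W"
      by (simp add: power3_eq_cube power2_eq_square)
    also have "\<dots> \<le> 1000 * \<kappa> ^ 3 * (1 / \<epsilon>\<^sup>2) * W"
      using T(4) W0 by (intro mult_right_mono) auto
    finally have TL: "real (T * L) \<le> 1000 * \<kappa> ^ 3 * (1 / \<epsilon>\<^sup>2) * W" .
    \<comment> \<open>\<open>T\<close> and \<open>L\<close> are fixed before the starting point is
      introduced, so one choice serves every warm start.\<close>
    have success: "measure (sgd_random_iterate orc T L (step_size R\<^sub>0 G T) X\<^sub>1)
            {X \<in> spectrahedron. f X - f Xopt \<le> \<epsilon>} \<ge> 1/2 \<and>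
          measure (sgd_average orc T L (step_size R\<^sub>0 G T) X\<^sub>1)
            {X \<in> spectrahedron. f X - f Xopt \<le> \<epsilon>} \<ge> 1/2"
      if X1: "X\<^sub>1 \<in> spectrahedron" "norm (X\<^sub>1 - Xopt) \<le> R\<^sub>0 / 2" for X\<^sub>1
    proof -
      have "0 < step_size R\<^sub>0 G T"
        using Rpos pos T(1) by (simp add: step_size_def)
      then interpret projected_sgd f f' orc Xopt X\<^sub>1 G B \<sigma> "step_size R\<^sub>0 G T" L
        using assms X1 L1 by unfold_locales auto
      have "((norm (X\<^sub>1 - Xopt))\<^sup>2 + real T * ((step_size R\<^sub>0 G T)\<^sup>2 * G\<^sup>2)) / (2 * step_size R\<^sub>0 G T * real T)
          \<le> 13/10 * a * ln (8 * real T) / sqrt (real T)"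
        unfolding a_def using Rpos pos T(1) X1 by (intro step_size_error) auto
      \<comment> \<open>The horizon was chosen with 13/5, twice 13/10, so that the mean gap is at
        most half of \<open>\<epsilon>\<close>, as Markov's inequality requires.\<close>
      also have "\<dots> \<le> \<epsilon> / 2" using T(6) by simp
      finally show ?thesis
        using random_iterate_success[OF T(1)] average_success[OF T(1)] \<epsilon> by blast
    qed
    show "\<exists>T\<ge>1. \<exists>L\<ge>1.
       batch_scale n r G B \<sigma> \<delta> R\<^sub>0 T \<le> real L \<and>
       real L \<le> 2 * batch_scale n r G B \<sigma> \<delta> R\<^sub>0 T \<and>
       real (T * L) \<le> 1000 * (ln (real n / \<epsilon>)) ^ 3 * (1 / \<epsilon>\<^sup>2) *
          max (\<sigma>\<^sup>2) ((eigval r Xopt)\<^sup>2 * real r * G\<^sup>2) \<and>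
       (\<forall>X\<^sub>1 \<in> spectrahedron. rank X\<^sub>1 \<le> r \<and> norm (X\<^sub>1 - Xopt) \<le> R\<^sub>0 / 2 \<longrightarrow>
          measure (sgd_random_iterate orc T L (step_size R\<^sub>0 G T) X\<^sub>1)
            {X \<in> spectrahedron. f X - f Xopt \<le> \<epsilon>} \<ge> 1/2 \<and>
          measure (sgd_average orc T L (step_size R\<^sub>0 G T) X\<^sub>1)
            {X \<in> spectrahedron. f X - f Xopt \<le> \<epsilon>} \<ge> 1/2)"
    proof (rule exI[of _ T], intro exI[of _ L] conjI ballI impI)
      show "batch_scale n r G B \<sigma> \<delta> R\<^sub>0 T \<le> real L"
        "real L \<le> 2 * batch_scale n r G B \<sigma> \<delta> R\<^sub>0 T" using L by (auto simp: S_def)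
      show "real (T * L) \<le> 1000 * (ln (real n / \<epsilon>)) ^ 3 * (1 / \<epsilon>\<^sup>2) *
          max (\<sigma>\<^sup>2) ((eigval r Xopt)\<^sup>2 * real r * G\<^sup>2)"
        using TL by (simp only: \<kappa>_def W_def ev_def)
    qed (use T(1) L1 success in auto)
  qed (fact \<open>\<epsilon>\<^sub>0 > 0\<close>)
qed

end
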